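(* The symmetric canonical elements of $Sp(n)$ are precisely the elements of the form $\xi_I+\delta_I(n)H_n$ with $I\subseteq\{1,\ldots,n\}$, where $\xi_I=\sum_{i\in I}H_i$, and $\delta_I(n)=1$ if $n\in I$, $\delta_I(n)=0$ if $n\notin I$.
   Context: General setting. Let $G$ be a compact connected Lie group with Lie algebra $\mathfrak g$, $\mathfrak t\subset\mathfrak g$ a maximal torus (maximal abelian subalgebra), $\alpha_1,\ldots,\alpha_n\in\sqrt{-1}\,\mathfrak t^*$ the positive simple roots for a chosen set of positive roots $\Delta^+$, and $H_1,\ldots,H_n\in\mathfrak t$ the dual basis: $\alpha_i(H_j)=\sqrt{-1}\,\delta_{ij}$. Put $\mathfrak I(G)=\{\xi\in\mathfrak t:\exp_G(2\pi\xi)=e\}$, $\mathfrak I'(G)=\{\xi\in\mathfrak I(G): \alpha(\xi)/\sqrt{-1}\ge 0 \text{ for all }\alpha\in\Delta^+\}$ and $\mathfrak I^2(G)=\{\xi\in\mathfrak t:\exp_G(\pi\xi)=e\}$. For $\xi\in\mathfrak I'(G)$ let $\mathfrak g^\xi_j$ ($j\in\mathbb Z$) be the $\sqrt{-1}\,j$-eigenspace of $\mathrm{ad}\,\xi$ on $\mathfrak g^{\mathbb C}$ and $\mathfrak p_i^\xi=\bigoplus_{j\le i}\mathfrak g_j^\xi$. Define $\xi\preceq\xi'$ iff $\mathfrak p^\xi_i\subseteq\mathfrak p^{\xi'}_i$ for all $i\ge 0$ (writing $\xi=\sum n_iH_i$, $\xi'=\sum n_i'H_i$, this is equivalent to $n_i'\le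 n_i$ for all $i$). Define a second partial order on $\mathfrak I'(G)$ by: $\xi\preceq_{\mathcal I}\xi'$ iff $\xi\preceq\xi'$ and $\xi-\xi'\in\mathfrak I^2(G)$. A symmetric canonical element of $G$ is a maximal element of $(\mathfrak I'(G),\preceq_{\mathcal I})$. The case $(C_n)$. $G=Sp(n)=\{X\in U(2n): XJ=JX\}$, where $J:\mathbb C^{2n}\to\mathbb C^{2n}$ is the anti-linear map representing left multiplication by the quaternion $j$. With respect to an orthonormal basis $e_1,\ldots,e_{2n}$ of $\mathbb C^{2n}$ with $e_{n+i}=Je_i$, $E_i$ is the diagonal matrix with $E_ie_i=\sqrt{-1}e_i$, $E_ie_{n+i}=-\sqrt{-1}e_{n+i}$ and zero on the other basis vectors. $\mathfrak t=\{\sum a_iE_i:a_i\in\mathbb R\}$, $L_i(E_j)=\sqrt{-1}\,\delta_{ij}$. The positive roots are $\Delta^+=\{L_i+L_j\}_{i\le j}\cup\{L_i-L_j\}_{i<j}$, with simple roots $\alpha_i=L_i-L_{i+1}$ for $1\le i\le n-1$ and $\alpha_n=2L_n$, so that $H_i=E_1+\ldots+E_i$ for $i\le n-1$ and $H_n=\frac12(E_1+\ldots+E_n)$. *)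

theory Defs
  imports "Jordan_Normal_Form.Schur_Decomposition"
begin

section \<open>Matrix Lie groups\<close>

text \<open>
  A compact connected Lie group is given as a set \<open>G\<close> of complex \<open>N \<times> N\<close> matrices, with a maximal
  torus \<open>T\<close> of its Lie algebra and a set \<open>\<Delta>\<close> of positive roots, viewed as functions on matrices of
  which only the values on \<open>T\<close> matter.
\<close>

text \<open>
  The exponential series is summed entrywise. It converges for every square matrix, so the default
  value of \<^const>\<open>suminf\<close> never enters.
\<close>

definition mat_exp :: "complex mat \<Rightarrow> complex mat" where
  "mat_exp A = mat (dim_row A) (dim_row A) (\<lambda>(r, c). \<Sum>k. (A ^\<^sub>m k) $$ (r, c) / fact k)"

definition lie_algebra :: "nat \<Rightarrow> complex mat set \<Rightarrow> complex mat set" where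
  "lie_algebra N G =
     {X \<in> carrier_mat N N. \<forall>s::real. mat_exp (complex_of_real s \<cdot>\<^sub>m X) \<in> G}"

text \<open>
  For \<open>G\<close> inside a unitary group the Lie algebra \<open>g\<close> consists of skew-Hermitian matrices, so
  \<open>g\<close> and \<open>\<i> g\<close> intersect in zero and the complexification is \<open>g + \<i> g\<close> inside the matrices.
\<close>

definition lie_algebra_C :: "nat \<Rightarrow> complex mat set \<Rightarrow> complex mat set" where
  "lie_algebra_C N G = {X + \<i> \<cdot>\<^sub>m Y |X Y. X \<in> lie_algebra N G \<and> Y \<in> lie_algebra N G}"

definition int_lattice :: "nat \<Rightarrow> complex mat set \<Rightarrow> complex mat set" where
  "int_lattice N T = {\<xi> \<in> T. mat_exp (complex_of_real (2 * pi) \<cdot>\<^sub>m \<xi>) = 1\<^sub>m N}"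

text \<open>
  In the following definition \<open>\<le>\<close> is the order on complex numbers:
  \<open>0 \<le> z\<close> says that \<open>z\<close> is real and nonnegative.
\<close>

definition dominant_lattice ::
    "nat \<Rightarrow> complex mat set \<Rightarrow> (complex mat \<Rightarrow> complex) set \<Rightarrow> complex mat set" where
  "dominant_lattice N T \<Delta> = {\<xi> \<in> int_lattice N T. \<forall>\<alpha>\<in>\<Delta>. 0 \<le> \<alpha> \<xi> / \<i>}"

definition square_lattice :: "nat \<Rightarrow> complex mat set \<Rightarrow> complex mat set" where
  "square_lattice N T = {\<xi> \<in> T. mat_exp (complex_of_real pi \<cdot>\<^sub>m \<xi>) = 1\<^sub>m N}"

definition ad_eigenspace :: "nat \<Rightarrow> complex mat set \<Rightarrow> complex mat \<Rightarrow> int \<Rightarrow> complex mat set" where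
  "ad_eigenspace N G \<xi> j =
     {X \<in> lie_algebra_C N G. \<xi> * X - X * \<xi> = (\<i> * of_int j) \<cdot>\<^sub>m X}"

text \<open>
  The direct sum over the infinite set of all \<open>j \<le> i\<close>, as the set of all finite sums of
  eigenvectors; it is direct because eigenvectors to distinct eigenvalues are independent.
\<close>

definition parab :: "nat \<Rightarrow> complex mat set \<Rightarrow> complex mat \<Rightarrow> int \<Rightarrow> complex mat set" where
  "parab N G \<xi> i =
     {(\<Oplus>\<^bsub>module_mat TYPE(complex) N N\<^esub>j\<in>S. Y j) |S Y.
        finite S \<and> S \<subseteq> {..i} \<and> (\<forall>j\<in>S. Y j \<in> ad_eigenspace N G \<xi> j)}"

definition prec :: "nat \<Rightarrow> complex mat set \<Rightarrow> complex mat \<Rightarrow> complex mat \<Rightarrow> bool" where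
  "prec N G \<xi> \<xi>' \<longleftrightarrow> (\<forall>i\<ge>0. parab N G \<xi> i \<subseteq> parab N G \<xi>' i)"

definition prec_I ::
    "nat \<Rightarrow> complex mat set \<Rightarrow> complex mat set \<Rightarrow> complex mat \<Rightarrow> complex mat \<Rightarrow> bool" where
  "prec_I N G T \<xi> \<xi>' \<longleftrightarrow> prec N G \<xi> \<xi>' \<and> \<xi> - \<xi>' \<in> square_lattice N T"

definition symmetric_canonical_elements ::
    "nat \<Rightarrow> complex mat set \<Rightarrow> complex mat set \<Rightarrow> (complex mat \<Rightarrow> complex) set \<Rightarrow> complex mat set"
  where
  "symmetric_canonical_elements N G T \<Delta> =
     {\<xi> \<in> dominant_lattice N T \<Delta>. \<forall>\<xi>'\<in>dominant_lattice N T \<Delta>. prec_I N G T \<xi> \<xi>' \<longrightarrow> \<xi>' = \<xi>}"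

definition dual_basis ::
    "complex mat set \<Rightarrow> nat \<Rightarrow> (nat \<Rightarrow> complex mat \<Rightarrow> complex) \<Rightarrow> nat \<Rightarrow> complex mat" where
  "dual_basis T n \<alpha> j =
     (THE H. H \<in> T \<and> (\<forall>i\<in>{1..n}. \<alpha> i H = (if i = j then \<i> else 0)))"


section \<open>The symplectic group\<close>

text \<open>
  The basis vector \<open>e\<^sub>k\<close> is the standard one with index \<open>k - 1\<close>, since matrix and vector indices start
  at zero. The map \<open>J\<close> is the anti-linear one with \<open>J e\<^sub>i = e\<^bsub>n+i\<^esub>\<close> and \<open>J e\<^bsub>n+i\<^esub> = - e\<^sub>i\<close>.
\<close>

definition sp_J :: "nat \<Rightarrow> complex vec \<Rightarrow> complex vec" where
  "sp_J n v = vec (2 * n) (\<lambda>r. if r < n then - cnj (v $ (n + r)) else cnj (v $ (r - n)))"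

definition unitary_group :: "nat \<Rightarrow> complex mat set" where
  "unitary_group N = {X \<in> carrier_mat N N. mat_adjoint X * X = 1\<^sub>m N}"

definition Sp :: "nat \<Rightarrow> complex mat set" where
  "Sp n = {X \<in> unitary_group (2 * n).
     \<forall>v\<in>carrier_vec (2 * n). X *\<^sub>v sp_J n v = sp_J n (X *\<^sub>v v)}"

definition sp_E :: "nat \<Rightarrow> nat \<Rightarrow> complex mat" where
  "sp_E n i = mat (2 * n) (2 * n) (\<lambda>(r, c).
     if r = c \<and> r + 1 = i then \<i> else if r = c \<and> r + 1 = n + i then - \<i> else 0)"

definition sp_torus :: "nat \<Rightarrow> complex mat set" where
  "sp_torus n =
     {(\<Oplus>\<^bsub>module_mat TYPE(complex) (2 * n) (2 * n)\<^esub>i\<in>{1..n}. complex_of_real (a i) \<cdot>\<^sub>m sp_E n i) |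
        a :: nat \<Rightarrow> real. True}"

text \<open>The functional dual to \<open>E\<^sub>i\<close> on the torus reads off a diagonal entry, see \<open>sp_L_E\<close> below.\<close>

definition sp_L :: "nat \<Rightarrow> complex mat \<Rightarrow> complex" where
  "sp_L i X = X $$ (i - 1, i - 1)"

definition sp_pos_roots :: "nat \<Rightarrow> (complex mat \<Rightarrow> complex) set" where
  "sp_pos_roots n =
     {(\<lambda>X. sp_L i X + sp_L j X) |i j. 1 \<le> i \<and> i \<le> j \<and> j \<le> n} \<union>
     {(\<lambda>X. sp_L i X - sp_L j X) |i j. 1 \<le> i \<and> i < j \<and> j \<le> n}"

definition sp_simple_root :: "nat \<Rightarrow> nat \<Rightarrow> complex mat \<Rightarrow> complex" where
  "sp_simple_root n i X = (if i < n then sp_L i X - sp_L (i + 1) X else 2 * sp_L n X)"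

definition sp_H :: "nat \<Rightarrow> nat \<Rightarrow> complex mat" where
  "sp_H n = dual_basis (sp_torus n) n (sp_simple_root n)"

definition sp_xi :: "nat \<Rightarrow> nat set \<Rightarrow> complex mat" where
  "sp_xi n I = (\<Oplus>\<^bsub>module_mat TYPE(complex) (2 * n) (2 * n)\<^esub>i\<in>I. sp_H n i)"

definition sp_delta :: "nat set \<Rightarrow> nat \<Rightarrow> complex" where
  "sp_delta I n = (if n \<in> I then 1 else 0)"


subsection \<open>The explicit form of the dual basis\<close>

lemma sp_E_carrier [simp]: "sp_E n i \<in> carrier_mat (2 * n) (2 * n)"
  by (simp add: sp_E_def)

lemma sp_L_E:
  assumes "i \<in> {1..n}" "j \<in> {1..n}"
  shows "sp_L i (sp_E n j) = (if i = j then \<i> else 0)"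
  using assms by (auto simp: sp_L_def sp_E_def)

lemma finsum_mat_closed:
  assumes "finite S" "\<And>i. i \<in> S \<Longrightarrow> f i \<in> carrier_mat N N"
  shows "(\<Oplus>\<^bsub>module_mat TYPE(complex) N N\<^esub>i\<in>S. f i) \<in> carrier_mat N N"
proof -
  interpret M: abelian_group "module_mat TYPE(complex) N N" by (rule abelian_group_mat)
  show ?thesis using M.finsum_closed[of f S] assms by (auto simp: module_mat_simps)
qed

lemma index_finsum_mat:
  assumes "finite S" "\<And>i. i \<in> S \<Longrightarrow> f i \<in> carrier_mat N N" "r < N" "c < N"
  shows "(\<Oplus>\<^bsub>module_mat TYPE(complex) N N\<^esub>i\<in>S. f i) $$ (r, c) = (\<Sum>i\<in>S. f i $$ (r, c))"
  using assms(1,2)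
proof (induction S rule: finite_induct)
  interpret M: abelian_group "module_mat TYPE(complex) N N" by (rule abelian_group_mat)
  case empty
  then show ?case using assms(3,4) by (simp add: module_mat_simps)
next
  interpret M: abelian_group "module_mat TYPE(complex) N N" by (rule abelian_group_mat)
  case (insert x F)
  have "(\<Oplus>\<^bsub>module_mat TYPE(complex) N N\<^esub>i\<in>insert x F. f i) =
      f x + (\<Oplus>\<^bsub>module_mat TYPE(complex) N N\<^esub>i\<in>F. f i)"
    using M.finsum_insert[of F x f] insert by (auto simp: module_mat_simps)
  moreover have "(\<Oplus>\<^bsub>module_mat TYPE(complex) N N\<^esub>i\<in>F. f i) \<in> carrier_mat N N"
    using insert by (intro finsum_mat_closed) auto
  ultimately show ?case using insert assms(3,4) by auto
qed

lemma sp_L_torus: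
  assumes "i \<in> {1..n}"
  shows "sp_L i (\<Oplus>\<^bsub>module_mat TYPE(complex) (2 * n) (2 * n)\<^esub>j\<in>{1..n}.
           complex_of_real (a j) \<cdot>\<^sub>m sp_E n j) = \<i> * complex_of_real (a i)"
proof -
  have "sp_L i (\<Oplus>\<^bsub>module_mat TYPE(complex) (2 * n) (2 * n)\<^esub>j\<in>{1..n}.
           complex_of_real (a j) \<cdot>\<^sub>m sp_E n j)
      = (\<Sum>j\<in>{1..n}. (complex_of_real (a j) \<cdot>\<^sub>m sp_E n j) $$ (i - 1, i - 1))"
    unfolding sp_L_def using assms by (intro index_finsum_mat) auto
  also have "\<dots> = (\<Sum>j\<in>{1..n}. if i = j then \<i> * complex_of_real (a i) else 0)"
    using assms by (intro sum.cong) (auto simp: sp_E_def)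
  also have "\<dots> = \<i> * complex_of_real (a i)" using assms by simp
  finally show ?thesis .
qed

lemma sp_torus_eqI:
  assumes "X \<in> sp_torus n" "Y \<in> sp_torus n"
    and eq: "\<And>i. i \<in> {1..n} \<Longrightarrow> sp_simple_root n i X = sp_simple_root n i Y"
  shows "X = Y"
proof -
  let ?S = "\<lambda>a::nat \<Rightarrow> real. \<Oplus>\<^bsub>module_mat TYPE(complex) (2 * n) (2 * n)\<^esub>j\<in>{1..n}.
           complex_of_real (a j) \<cdot>\<^sub>m sp_E n j"
  obtain a b where X: "X = ?S a" and Y: "Y = ?S b"
    using assms(1,2) unfolding sp_torus_def by blast
  have ab: "a (n - k) = b (n - k)" if "k < n" for k
    using that
  proof (induction k)
    case 0
    then show ?case using eq[of n]
      by (simp add: sp_simple_root_def X Y sp_L_torus del: One_nat_def)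
  next
    case (Suc k)
    then have "Suc (n - Suc k) = n - k" by simp
    with Suc eq[of "n - Suc k"] show ?case
      by (auto simp: sp_simple_root_def X Y sp_L_torus simp del: One_nat_def
          simp flip: of_real_diff right_diff_distrib)
  qed
  have "a i = b i" if "i \<in> {1..n}" for i
    using ab[of "n - i"] that by auto
  then have "?S a $$ (r, c) = ?S b $$ (r, c)" if "r < 2 * n" "c < 2 * n" for r c
    using that by (subst (1 2) index_finsum_mat) auto
  moreover have "?S a \<in> carrier_mat (2 * n) (2 * n)" "?S b \<in> carrier_mat (2 * n) (2 * n)"
    by (intro finsum_mat_closed; simp)+
  ultimately show ?thesis unfolding X Y by (intro eq_matI) auto
qed

lemma sp_H_explicit:
  assumes j: "j \<in> {1..n}"
  shows "sp_H n j = (\<Oplus>\<^bsub>module_mat TYPE(complex) (2 * n) (2 * n)\<^esub>i\<in>{1..n}.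
    complex_of_real (if i \<le> j then if j < n then 1 else 1 / 2 else 0) \<cdot>\<^sub>m sp_E n i)"
    (is "_ = ?X")
proof -
  let ?P = "\<lambda>H. H \<in> sp_torus n \<and>
    (\<forall>i\<in>{1..n}. sp_simple_root n i H = (if i = j then \<i> else 0))"
  have P: "?P ?X"
  proof (intro conjI ballI)
    show "?X \<in> sp_torus n" unfolding sp_torus_def
      by (intro CollectI exI[of _ "\<lambda>i. if i \<le> j then if j < n then 1 else 1 / 2 else 0"]) simp
    show "sp_simple_root n i ?X = (if i = j then \<i> else 0)" if "i \<in> {1..n}" for i
      using that j unfolding sp_simple_root_def
      by (auto simp: sp_L_torus simp del: One_nat_def)
  qed
  have "H = ?X" if H: "?P H" for H
  proof (rule sp_torus_eqI)
    show "H \<in> sp_torus n" "?X \<in> sp_torus n" using H P by blast+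
    show "sp_simple_root n i H = sp_simple_root n i ?X" if "i \<in> {1..n}" for i
      using bspec[OF conjunct2[OF H] that] bspec[OF conjunct2[OF P] that] by (rule trans[OF _ sym])
  qed
  with P show ?thesis unfolding sp_H_def dual_basis_def by (rule the_equality)
qed

end

theory Submission
  imports Defs
begin

text \<open>
  The torus consists of the diagonal matrices \<open>\<i> diag(a\<^sub>1, \<dots>, a\<^sub>n, - a\<^sub>1, \<dots>, - a\<^sub>n)\<close>. Such a matrix lies in
  the integral lattice iff all \<open>a\<^sub>i\<close> are integers, and in \<open>\<II>\<^sup>2\<close> iff all \<open>a\<^sub>i\<close> are even. It is dominant iff
  \<open>a\<^sub>1 \<ge> \<dots> \<ge> a\<^sub>n \<ge> 0\<close>, so the dominant integral elements are parametrised by the differences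
  \<open>m\<^sub>j = a\<^sub>j - a\<^bsub>j+1\<^esub>\<close> (with \<open>a\<^bsub>n+1\<^esub> = 0\<close>), which are arbitrary natural numbers. In these coordinates

    \<^item> \<open>\<xi> - \<xi>'\<close> lies in \<open>\<II>\<^sup>2\<close> iff \<open>m\<^sub>j\<close> and \<open>m'\<^sub>j\<close> have the same parity for all \<open>j\<close>;
    \<^item> \<open>\<xi> \<preceq> \<xi>'\<close> iff \<open>m'\<^sub>j \<le> m\<^sub>j\<close> for all \<open>j\<close>.

  Hence an element is maximal iff no \<open>m\<^sub>j\<close> can be lowered by two, that is, iff all \<open>m\<^sub>j\<close> are zero or one.
  Since \<open>m\<^sub>j\<close> is the coefficient of \<open>H\<^sub>j\<close> for \<open>j < n\<close>, whereas \<open>2 m\<^sub>n\<close> is the coefficient of \<open>H\<^sub>n\<close> (as \<open>H\<^sub>n\<close> has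
  the half-integral entries \<open>1/2\<close>), these are the elements of the theorem, with \<open>I\<close> the set of \<open>j\<close> such
  that \<open>m\<^sub>j = 1\<close>.

  The description of \<open>\<preceq>\<close> is the part that sees the group. It needs the complexified Lie algebra of
  \<open>Sp(n)\<close> as an explicit space of matrices, cut out by one linear relation between pairs of entries
  (\<open>lie_algebra_C_Sp_iff\<close>). To get it, curves \<open>exp(s X)\<close> in the group are differentiated at zero for one
  inclusion, and for the other the exponential of a skew-Hermitian matrix commuting with \<open>J\<close> is shown
  to lie in \<open>Sp(n)\<close>. The relation preserves the weight of an entry, so membership of a matrix in
  \<open>\<pp>\<^sub>i\<close> only depends on the weights of its nonzero entries (\<open>parab_Sp\<close>), and \<open>\<preceq>\<close> becomes an
  inequality between weights (\<open>prec_Sp_iff_weights\<close>).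
\<close>

section \<open>The matrix exponential\<close>

lemma index_mult_mat_sum:
  assumes "A \<in> carrier_mat N K" "B \<in> carrier_mat K M" "r < N" "c < M"
  shows "(A * B) $$ (r, c) = (\<Sum>p<K. A $$ (r, p) * B $$ (p, c))"
  using assms by (auto simp: scalar_prod_def lessThan_atLeast0)

lemma pow_mat_add:
  assumes "(A :: 'a :: semiring_1 mat) \<in> carrier_mat N N"
  shows "A ^\<^sub>m (k + l) = A ^\<^sub>m k * A ^\<^sub>m l"
proof (induction l)
  case 0
  then show ?case using assms by simp
next
  case (Suc l)
  have "A ^\<^sub>m k \<in> carrier_mat N N" "A ^\<^sub>m l \<in> carrier_mat N N" using assms by simp_all
  with Suc assms show ?case by (simp add: assoc_mult_mat[of _ N N _ N _ N])
qed

lemma index_smult_pow_mat: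
  fixes A :: "'a :: comm_ring_1 mat"
  assumes "A \<in> carrier_mat N N" "r < N" "c < N"
  shows "((x \<cdot>\<^sub>m A) ^\<^sub>m k) $$ (r, c) = x ^ k * (A ^\<^sub>m k) $$ (r, c)"
  using assms(2,3)
proof (induction k arbitrary: r c)
  case 0
  then show ?case using assms(1) by simp
next
  case (Suc k)
  have A: "A ^\<^sub>m k \<in> carrier_mat N N" "(x \<cdot>\<^sub>m A) ^\<^sub>m k \<in> carrier_mat N N" "x \<cdot>\<^sub>m A \<in> carrier_mat N N"
    using assms(1) by simp_all
  show ?case
    unfolding pow_mat.simps index_mult_mat_sum[OF A(2,3) Suc.prems]
      index_mult_mat_sum[OF A(1) assms(1) Suc.prems]
    unfolding sum_distrib_left using Suc assms(1) by (intro sum.cong) (auto simp: ac_simps)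
qed

text \<open>
  This crude geometric bound suffices, as division by \<open>k!\<close> makes any geometric growth summable.
\<close>

lemma norm_index_pow_mat_le:
  fixes A :: "complex mat"
  assumes A: "A \<in> carrier_mat N N" and B: "\<And>r c. r < N \<Longrightarrow> c < N \<Longrightarrow> norm (A $$ (r, c)) \<le> B"
    and "r < N" "c < N"
  shows "norm ((A ^\<^sub>m k) $$ (r, c)) \<le> (of_nat N * B) ^ k"
  using assms(3,4)
proof (induction k arbitrary: r c)
  case 0
  then show ?case using A by auto
next
  case (Suc k)
  have Ak: "A ^\<^sub>m k \<in> carrier_mat N N" using A by simp
  have "0 \<le> B" using norm_ge_zero B[OF assms(3,4)] by (rule order_trans)
  have "norm ((A ^\<^sub>m Suc k) $$ (r, c)) \<le> (\<Sum>p<N. norm ((A ^\<^sub>m k) $$ (r, p)) * norm (A $$ (p, c)))"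
    unfolding pow_mat.simps index_mult_mat_sum[OF Ak A Suc.prems]
    by (rule order_trans[OF norm_sum]) (simp add: norm_mult)
  also have "\<dots> \<le> (\<Sum>p<N. (of_nat N * B) ^ k * B)"
    using Suc B \<open>0 \<le> B\<close> by (intro sum_mono mult_mono) auto
  also have "\<dots> = (of_nat N * B) ^ Suc k" by (simp add: ac_simps)
  finally show ?case .
qed

lemma summable_norm_mat_exp:
  fixes A :: "complex mat"
  assumes A: "A \<in> carrier_mat N N" and "r < N" "c < N"
  shows "summable (\<lambda>k. norm ((A ^\<^sub>m k) $$ (r, c) / fact k))"
proof -
  define B where "B = (\<Sum>r<N. \<Sum>c<N. norm (A $$ (r, c)))"
  have B: "norm (A $$ (r, c)) \<le> B" if "r < N" "c < N" for r c
  proof -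
    have "norm (A $$ (r, c)) \<le> (\<Sum>c<N. norm (A $$ (r, c)))"
      using that by (intro member_le_sum) auto
    also have "\<dots> \<le> B"
      unfolding B_def using that by (intro member_le_sum[where f = "\<lambda>r. \<Sum>c<N. norm (A $$ (r, c))"])
        (auto intro: sum_nonneg)
    finally show ?thesis .
  qed
  have "norm ((A ^\<^sub>m k) $$ (r, c) / fact k) \<le> inverse (fact k) * (of_nat N * B) ^ k" for k
    using norm_index_pow_mat_le[OF A B assms(2,3), of k]
    by (simp add: norm_divide field_simps)
  moreover have "summable (\<lambda>k. inverse (fact k) * (of_nat N * B :: real) ^ k)"
    by (rule summable_exp)
  ultimately show ?thesis
    by (intro summable_norm_comparison_test) auto
qed

lemma mat_exp_carrier [simp]: "A \<in> carrier_mat N N \<Longrightarrow> mat_exp A \<in> carrier_mat N N"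
  by (simp add: mat_exp_def)

lemma index_mat_exp:
  "A \<in> carrier_mat N N \<Longrightarrow> r < N \<Longrightarrow> c < N \<Longrightarrow>
    mat_exp A $$ (r, c) = (\<Sum>k. (A ^\<^sub>m k) $$ (r, c) / fact k)"
  by (simp add: mat_exp_def)

text \<open>
  In the Cauchy product of the two series the terms of total degree \<open>m\<close> add up to \<open>A\<^sup>m / m!\<close> times the
  alternating sum of the binomial coefficients \<open>m choose k\<close>, which vanishes unless \<open>m = 0\<close>.
\<close>

lemma mat_exp_uminus_mult:
  assumes A: "A \<in> carrier_mat N N"
  shows "mat_exp (- A) * mat_exp A = 1\<^sub>m N"
proof (rule eq_matI)
  have mA: "- A = (-1) \<cdot>\<^sub>m A" "- A \<in> carrier_mat N N" using A by auto
  fix a b assume "a < dim_row (1\<^sub>m N :: complex mat)" "b < dim_col (1\<^sub>m N :: complex mat)"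
  then have ab: "a < N" "b < N" by simp_all
  let ?u = "\<lambda>p k. ((- A) ^\<^sub>m k) $$ (a, p) / fact k"
  let ?v = "\<lambda>p k. (A ^\<^sub>m k) $$ (p, b) / fact k"
  have *: "(\<lambda>m. \<Sum>k\<le>m. ?u p k * ?v p (m - k)) sums ((\<Sum>k. ?u p k) * (\<Sum>k. ?v p k))"
    if "p < N" for p
    using that ab A mA by (intro Cauchy_product_sums summable_norm_mat_exp) auto
  have "(\<lambda>m. \<Sum>p<N. \<Sum>k\<le>m. ?u p k * ?v p (m - k)) sums
      (\<Sum>p<N. (\<Sum>k. ?u p k) * (\<Sum>k. ?v p k))"
    using * by (intro sums_sum) auto
  also have "(\<lambda>m. \<Sum>p<N. \<Sum>k\<le>m. ?u p k * ?v p (m - k)) =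
      (\<lambda>m. if m = 0 then 1\<^sub>m N $$ (a, b) else 0)"
  proof
    fix m
    have "(\<Sum>p<N. \<Sum>k\<le>m. ?u p k * ?v p (m - k)) =
        (\<Sum>k\<le>m. \<Sum>p<N. ?u p k * ?v p (m - k))" by (rule sum.swap)
    also have "\<dots> = (\<Sum>k\<le>m. (-1) ^ k * of_nat (m choose k) * ((A ^\<^sub>m m) $$ (a, b) / fact m))"
    proof (intro sum.cong refl)
      fix k assume k: "k \<in> {..m}"
      have "(A ^\<^sub>m m) $$ (a, b) = (A ^\<^sub>m k * A ^\<^sub>m (m - k)) $$ (a, b)"
        using pow_mat_add[OF A, of k "m - k"] k by simp
      also have "\<dots> = (\<Sum>p<N. (A ^\<^sub>m k) $$ (a, p) * (A ^\<^sub>m (m - k)) $$ (p, b))"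
        using A ab by (intro index_mult_mat_sum) auto
      finally show "(\<Sum>p<N. ?u p k * ?v p (m - k)) =
          (-1) ^ k * of_nat (m choose k) * ((A ^\<^sub>m m) $$ (a, b) / fact m)"
        using k ab unfolding mA(1)
        by (simp add: index_smult_pow_mat[OF A] binomial_fact sum_distrib_left sum_divide_distrib
            field_simps)
    qed
    also have "\<dots> = (\<Sum>k\<le>m. (-1) ^ k * of_nat (m choose k)) * ((A ^\<^sub>m m) $$ (a, b) / fact m)"
      by (simp add: sum_distrib_right sum_divide_distrib)
    also have "\<dots> = (if m = 0 then 1\<^sub>m N $$ (a, b) else 0)"
      using choose_alternating_sum[of m, where 'a = complex] A by auto
    finally show "(\<Sum>p<N. \<Sum>k\<le>m. ?u p k * ?v p (m - k)) = \<dots>" .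
  qed
  finally have "(\<lambda>m. if m = 0 then 1\<^sub>m N $$ (a, b) else 0) sums
      (\<Sum>p<N. (\<Sum>k. ?u p k) * (\<Sum>k. ?v p k))" .
  moreover have "(\<lambda>m. if m = 0 then 1\<^sub>m N $$ (a, b) else 0) sums (1\<^sub>m N $$ (a, b) :: complex)"
    using sums_single[of 0 "\<lambda>_. 1\<^sub>m N $$ (a, b) :: complex"] by simp
  ultimately have "(\<Sum>p<N. (\<Sum>k. ?u p k) * (\<Sum>k. ?v p k)) = 1\<^sub>m N $$ (a, b)"
    by (rule sums_unique2)
  then show "(mat_exp (- A) * mat_exp A) $$ (a, b) = 1\<^sub>m N $$ (a, b)"
    using ab by (simp add: index_mult_mat_sum[OF mat_exp_carrier[OF mA(2)] mat_exp_carrier[OF A]]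
        index_mat_exp[OF mA(2)] index_mat_exp[OF A])
qed (use A in \<open>auto simp: mat_exp_def\<close>)

text \<open>
  Each entry of \<open>exp(z A)\<close> is an everywhere convergent power series in \<open>z\<close>, so the value and the
  derivative at zero are its first two coefficients. This recovers \<open>A\<close> from the one-parameter group.
\<close>

lemma mat_exp_scaled_at_zero:
  assumes A: "A \<in> carrier_mat N N" and rc: "r < N" "c < N"
  shows "mat_exp (of_real 0 \<cdot>\<^sub>m A) $$ (r, c) = 1\<^sub>m N $$ (r, c)"
    and "((\<lambda>s::real. mat_exp (of_real s \<cdot>\<^sub>m A) $$ (r, c)) has_vector_derivative A $$ (r, c)) (at 0)"
proof -
  let ?c = "\<lambda>k. (A ^\<^sub>m k) $$ (r, c) / fact k"
  have eq: "mat_exp (z \<cdot>\<^sub>m A) $$ (r, c) = (\<Sum>k. ?c k * z ^ k)" for z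
    using A rc by (simp add: index_mat_exp[of _ N] index_smult_pow_mat[OF A] ac_simps)
  have "summable (\<lambda>k. ?c k * z ^ k)" for z
    using summable_norm_cancel[OF summable_norm_mat_exp[of "z \<cdot>\<^sub>m A", OF _ rc]] A rc
    by (simp add: index_smult_pow_mat[OF A] ac_simps)
  then have "((\<lambda>z. \<Sum>k. ?c k * z ^ k) has_field_derivative (\<Sum>k. diffs ?c k * 0 ^ k)) (at 0)"
    by (rule termdiffs_strong_converges_everywhere)
  then have "((\<lambda>z. \<Sum>k. ?c k * z ^ k) has_field_derivative A $$ (r, c)) (at (of_real 0))"
    using A by (simp add: diffs_def)
  from has_vector_derivative_real_field[OF this]
  show "((\<lambda>s::real. mat_exp (of_real s \<cdot>\<^sub>m A) $$ (r, c)) has_vector_derivative A $$ (r, c)) (at 0)"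
    by (simp add: eq)
  show "mat_exp (of_real 0 \<cdot>\<^sub>m A) $$ (r, c) = 1\<^sub>m N $$ (r, c)"
    unfolding eq using A powser_zero[of ?c] by simp
qed

lemma mat_diag_pow: "mat_diag N f ^\<^sub>m k = mat_diag N (\<lambda>i. f i ^ k :: 'a :: comm_ring_1)"
  proof (induction k)
  case 0
  show ?case by (simp, simp add: mat_diag_def)
next
  case (Suc k)
  then show ?case by (simp add: mult.commute)
qed

lemma mat_exp_diag: "mat_exp (mat_diag N f) = mat_diag N (\<lambda>i. exp (f i))"
proof (rule eq_matI)
  fix r c assume "r < dim_row (mat_diag N (\<lambda>i. exp (f i)))" "c < dim_col (mat_diag N (\<lambda>i. exp (f i)))"
  then have rc: "r < N" "c < N" by (simp_all add: mat_diag_def)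
  then show "mat_exp (mat_diag N f) $$ (r, c) = mat_diag N (\<lambda>i. exp (f i)) $$ (r, c)"
    unfolding index_mat_exp[OF mat_diag_dim rc] mat_diag_pow
    by (simp add: mat_diag_def exp_def scaleR_conv_of_real divide_inverse mult.commute)
qed (simp_all add: mat_exp_def mat_diag_def)

section \<open>Entrywise description of the symplectic group\<close>

text \<open>
  The index \<open>sp_flip n r\<close> is that of the basis vector proportional to the image of the basis vector with
  index \<open>r\<close> under \<open>J\<close>, and \<open>sp_sign n r\<close> is the proportionality factor. As the torus acts on the two with
  opposite weights, this involution of indices carries all of the symplectic structure below.
\<close>

definition sp_flip :: "nat \<Rightarrow> nat \<Rightarrow> nat" where
  "sp_flip n r = (if r < n then n + r else r - n)"

definition sp_sign :: "nat \<Rightarrow> nat \<Rightarrow> complex" where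
  "sp_sign n r = (if r < n then 1 else - 1)"

lemma sp_flip_less [simp]: "r < 2 * n \<Longrightarrow> sp_flip n r < 2 * n"
  and sp_flip_flip [simp]: "r < 2 * n \<Longrightarrow> sp_flip n (sp_flip n r) = r"
  and sp_sign_flip [simp]: "r < 2 * n \<Longrightarrow> sp_sign n (sp_flip n r) = - sp_sign n r"
  and sp_sign_square [simp]: "sp_sign n r * sp_sign n r = 1"
    "sp_sign n r * (sp_sign n r * z) = z"
  and cnj_sp_sign [simp]: "cnj (sp_sign n r) = sp_sign n r"
  by (auto simp: sp_flip_def sp_sign_def)

lemma sp_flip_eq_iff: "r < 2 * n \<Longrightarrow> s < 2 * n \<Longrightarrow> sp_flip n r = s \<longleftrightarrow> r = sp_flip n s"
  by auto

lemma sum_sp_flip: "(\<Sum>c<2 * n. f (sp_flip n c)) = (\<Sum>c<2 * n. f c)"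
  by (rule sum.reindex_bij_witness[of _ "sp_flip n" "sp_flip n"]) auto

lemma index_sp_J:
  "r < 2 * n \<Longrightarrow> sp_J n v $ r = - sp_sign n r * cnj (v $ sp_flip n r)"
  by (auto simp: sp_J_def sp_sign_def sp_flip_def)

text \<open>
  Commutation with \<open>J\<close>, written out in matrix entries; see \<open>commutes_sp_J_iff\<close>.
\<close>

definition quaternionic :: "nat \<Rightarrow> complex mat \<Rightarrow> bool" where
  "quaternionic n X \<longleftrightarrow> (\<forall>r<2 * n. \<forall>c<2 * n.
     X $$ (sp_flip n r, sp_flip n c) = sp_sign n r * sp_sign n c * cnj (X $$ (r, c)))"

lemma index_mult_mat_vec_sum:
  assumes "A \<in> carrier_mat N M" "v \<in> carrier_vec M" "r < N"
  shows "(A *\<^sub>v v) $ r = (\<Sum>c<M. A $$ (r, c) * v $ c)"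
  using assms by (auto simp: scalar_prod_def lessThan_atLeast0)

text \<open>
  Evaluation at basis vectors extracts the entries. Because \<open>J\<close> is anti-linear, the entries of \<open>X\<close> on
  the right-hand side appear conjugated, and summation over flipped indices matches both sides.
\<close>

lemma commutes_sp_J_iff:
  assumes X: "X \<in> carrier_mat (2 * n) (2 * n)"
  shows "(\<forall>v\<in>carrier_vec (2 * n). X *\<^sub>v sp_J n v = sp_J n (X *\<^sub>v v)) \<longleftrightarrow> quaternionic n X"
proof
  have J: "sp_J n v \<in> carrier_vec (2 * n)" for v by (simp add: sp_J_def)
  have left: "(X *\<^sub>v sp_J n v) $ sp_flip n r =
      (\<Sum>c<2 * n. X $$ (sp_flip n r, sp_flip n c) * sp_sign n c * cnj (v $ c))"
    if "r < 2 * n" for v r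
    \<comment> \<open>\<open>J\<close> permutes the coordinates by the flip, so the sum is reindexed by it.\<close>
    unfolding index_mult_mat_vec_sum[OF X J sp_flip_less[OF that]]
    by (subst sum_sp_flip[symmetric], intro sum.cong) (auto simp: index_sp_J)
  have right: "sp_J n (X *\<^sub>v v) $ sp_flip n r =
      sp_sign n r * (\<Sum>c<2 * n. cnj (X $$ (r, c)) * cnj (v $ c))"
    if "r < 2 * n" "v \<in> carrier_vec (2 * n)" for v r
    using that by (simp add: index_sp_J index_mult_mat_vec_sum[OF X])
  {
    assume L: "\<forall>v\<in>carrier_vec (2 * n). X *\<^sub>v sp_J n v = sp_J n (X *\<^sub>v v)"
    show "quaternionic n X" unfolding quaternionic_def
    proof (intro allI impI)
      fix r c assume rc: "r < 2 * n" "c < 2 * n"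
      let ?e = "unit_vec (2 * n) c :: complex vec"
      have e: "?e \<in> carrier_vec (2 * n)" by simp
      have "(\<Sum>p<2 * n. X $$ (sp_flip n r, sp_flip n p) * sp_sign n p * cnj (?e $ p)) =
          sp_sign n r * (\<Sum>p<2 * n. cnj (X $$ (r, p)) * cnj (?e $ p))"
        using left[OF rc(1), of ?e] right[OF rc(1) e] bspec[OF L e] by simp
      moreover have "(\<Sum>p<2 * n. f p * cnj (?e $ p)) = f c" for f
      proof -
        have "(\<Sum>p<2 * n. f p * cnj (?e $ p)) = (\<Sum>p<2 * n. if c = p then f c else 0)"
          using rc by (intro sum.cong) auto
        then show ?thesis using rc by simp
      qed
      ultimately have "X $$ (sp_flip n r, sp_flip n c) * sp_sign n c = sp_sign n r * cnj (X $$ (r, c))"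
        by simp
      then have "X $$ (sp_flip n r, sp_flip n c) * sp_sign n c * sp_sign n c =
          sp_sign n r * cnj (X $$ (r, c)) * sp_sign n c" by simp
      then show "X $$ (sp_flip n r, sp_flip n c) = sp_sign n r * sp_sign n c * cnj (X $$ (r, c))"
        by (simp add: ac_simps)
    qed
  next
    assume Q: "quaternionic n X"
    show "\<forall>v\<in>carrier_vec (2 * n). X *\<^sub>v sp_J n v = sp_J n (X *\<^sub>v v)"
    proof (intro ballI eq_vecI)
      fix v :: "complex vec" and p assume v: "v \<in> carrier_vec (2 * n)"
        and "p < dim_vec (sp_J n (X *\<^sub>v v))"
      then have p: "p < 2 * n" by (simp add: sp_J_def)
      define r where "r = sp_flip n p"
      have r: "r < 2 * n" "p = sp_flip n r" using p by (simp_all add: r_def)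
      show "(X *\<^sub>v sp_J n v) $ p = sp_J n (X *\<^sub>v v) $ p"
        unfolding r(2) left[OF r(1)] right[OF r(1) v] sum_distrib_left
        using Q r(1) by (intro sum.cong) (auto simp: quaternionic_def ac_simps)
    qed (use X in \<open>simp add: sp_J_def\<close>)
  }
qed

lemma index_mat_adjoint:
  "X \<in> carrier_mat N M \<Longrightarrow> r < M \<Longrightarrow> c < N \<Longrightarrow> mat_adjoint X $$ (r, c) = cnj (X $$ (c, r))"
  by (simp add: mat_adjoint_def mat_of_rows_index)

lemma mat_adjoint_carrier: "X \<in> carrier_mat N M \<Longrightarrow> mat_adjoint X \<in> carrier_mat M N"
  unfolding mat_adjoint_def using mat_of_rows_carrier(1)[of N "map conjugate (cols X)"] by auto

lemma unitary_group_iff: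
  "X \<in> unitary_group N \<longleftrightarrow> X \<in> carrier_mat N N \<and>
    (\<forall>a<N. \<forall>b<N. (\<Sum>p<N. cnj (X $$ (p, a)) * X $$ (p, b)) = 1\<^sub>m N $$ (a, b))"
proof (cases "X \<in> carrier_mat N N")
  case X: True
  have M: "mat_adjoint X * X \<in> carrier_mat N N"
    using mat_adjoint_carrier[OF X] X by simp
  have "(mat_adjoint X * X) $$ (a, b) = (\<Sum>p<N. cnj (X $$ (p, a)) * X $$ (p, b))"
    if "a < N" "b < N" for a b
    unfolding index_mult_mat_sum[OF mat_adjoint_carrier[OF X] X that]
    using that by (intro sum.cong) (auto simp: index_mat_adjoint[OF X])
  moreover have "mat_adjoint X * X = 1\<^sub>m N \<longleftrightarrow>
      (\<forall>a<N. \<forall>b<N. (mat_adjoint X * X) $$ (a, b) = 1\<^sub>m N $$ (a, b))"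
    using M by (auto intro!: eq_matI)
  ultimately show ?thesis using X by (auto simp: unitary_group_def)
qed (auto simp: unitary_group_def)

lemma Sp_iff:
  "X \<in> Sp n \<longleftrightarrow> X \<in> unitary_group (2 * n) \<and> quaternionic n X"
  unfolding Sp_def using commutes_sp_J_iff by (auto simp: unitary_group_def)

section \<open>The Lie algebra of the symplectic group\<close>

definition skew_hermitian :: "nat \<Rightarrow> complex mat \<Rightarrow> bool" where
  "skew_hermitian N X \<longleftrightarrow> (\<forall>r<N. \<forall>c<N. X $$ (c, r) = - cnj (X $$ (r, c)))"

lemma skew_hermitianD:
  "skew_hermitian N X \<Longrightarrow> r < N \<Longrightarrow> c < N \<Longrightarrow> X $$ (c, r) = - cnj (X $$ (r, c))"
  unfolding skew_hermitian_def by blast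

lemma has_vector_derivative_eqI:
  assumes "(f has_vector_derivative x) (at (t :: real))" "(f has_vector_derivative y) (at t)"
  shows "x = y"
  using has_derivative_unique[OF assms[unfolded has_vector_derivative_def]]
  by (metis scaleR_one)

lemma has_vector_derivative_cnj:
  "(f has_vector_derivative x) F \<Longrightarrow> ((\<lambda>s. cnj (f s)) has_vector_derivative cnj x) F"
  by (rule bounded_linear.has_vector_derivative[OF bounded_linear_cnj])

text \<open>
  The derivative of \<open>exp(s X)\<^sup>* exp(s X) = 1\<close> at \<open>s = 0\<close> is \<open>X\<^sup>* + X = 0\<close>.
\<close>

lemma lie_algebra_unitary_imp_skew_hermitian:
  assumes X: "X \<in> carrier_mat N N"
    and U: "\<And>s::real. mat_exp (of_real s \<cdot>\<^sub>m X) \<in> unitary_group N"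
  shows "skew_hermitian N X"
  unfolding skew_hermitian_def
proof (intro allI impI)
  fix a b assume ab: "a < N" "b < N"
  let ?f = "\<lambda>s p b. mat_exp (of_real s \<cdot>\<^sub>m X) $$ (p, b)"
  have "((\<lambda>s. \<Sum>p<N. cnj (?f s p a) * ?f s p b) has_vector_derivative
      (\<Sum>p<N. cnj (?f 0 p a) * X $$ (p, b) + cnj (X $$ (p, a)) * ?f 0 p b)) (at 0)"
    using ab by (intro has_vector_derivative_sum has_vector_derivative_mult
      has_vector_derivative_cnj mat_exp_scaled_at_zero[OF X]) auto
  also have "(\<lambda>s. \<Sum>p<N. cnj (?f s p a) * ?f s p b) = (\<lambda>s. 1\<^sub>m N $$ (a, b))"
    using U ab by (auto simp: unitary_group_iff)
  finally have "(\<Sum>p<N. cnj (?f 0 p a) * X $$ (p, b) + cnj (X $$ (p, a)) * ?f 0 p b) = 0"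
    by (rule has_vector_derivative_eqI) simp
  also have "(\<Sum>p<N. cnj (?f 0 p a) * X $$ (p, b) + cnj (X $$ (p, a)) * ?f 0 p b) =
      (\<Sum>p<N. (if p = a then X $$ (a, b) else 0) + (if p = b then cnj (X $$ (b, a)) else 0))"
    using ab mat_exp_scaled_at_zero(1)[OF X] by (intro sum.cong) auto
  also have "\<dots> = X $$ (a, b) + cnj (X $$ (b, a))"
    using ab by (simp add: sum.distrib)
  finally show "X $$ (b, a) = - cnj (X $$ (a, b))"
    by (metis complex_cnj_add complex_cnj_cnj complex_cnj_zero eq_neg_iff_add_eq_0 add.commute)
qed

text \<open>
  The condition is linear over the reals, so it passes from the curve to its derivative at zero.
\<close>

lemma lie_algebra_quaternionic_imp_quaternionic:
  assumes X: "X \<in> carrier_mat (2 * n) (2 * n)"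
    and Q: "\<And>s::real. quaternionic n (mat_exp (of_real s \<cdot>\<^sub>m X))"
  shows "quaternionic n X"
  unfolding quaternionic_def
proof (intro allI impI)
  fix r c assume rc: "r < 2 * n" "c < 2 * n"
  let ?f = "\<lambda>r c (s::real). mat_exp (of_real s \<cdot>\<^sub>m X) $$ (r, c)"
  have "((\<lambda>s. sp_sign n r * sp_sign n c * cnj (?f r c s)) has_vector_derivative
      sp_sign n r * sp_sign n c * cnj (X $$ (r, c))) (at 0)"
    using rc by (intro has_vector_derivative_mult_right
      has_vector_derivative_cnj mat_exp_scaled_at_zero[OF X]) auto
  also have "(\<lambda>s. sp_sign n r * sp_sign n c * cnj (?f r c s)) = ?f (sp_flip n r) (sp_flip n c)"
    using Q rc by (auto simp: quaternionic_def)
  finally show "X $$ (sp_flip n r, sp_flip n c) = sp_sign n r * sp_sign n c * cnj (X $$ (r, c))"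
    using rc by (intro has_vector_derivative_eqI[OF mat_exp_scaled_at_zero(2)[OF X]]) auto
qed

lemma skew_hermitian_pow:
  assumes X: "X \<in> carrier_mat N N" and S: "skew_hermitian N X" and rc: "r < N" "c < N"
  shows "(X ^\<^sub>m k) $$ (c, r) = (-1) ^ k * cnj ((X ^\<^sub>m k) $$ (r, c))"
  using rc
proof (induction k arbitrary: r c)
  case 0
  then show ?case using X by auto
next
  case (Suc k)
  have Xk: "X ^\<^sub>m k \<in> carrier_mat N N" using X by simp
  have comm: "X ^\<^sub>m Suc k = X * X ^\<^sub>m k" using pow_mat_add[OF X, of 1 k] X by simp
  have "(X ^\<^sub>m Suc k) $$ (c, r) = (\<Sum>p<N. X $$ (c, p) * (X ^\<^sub>m k) $$ (p, r))"
    unfolding comm using Suc.prems by (intro index_mult_mat_sum[OF X Xk])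
  also have "\<dots> = (\<Sum>p<N. - cnj (X $$ (p, c)) * ((-1) ^ k * cnj ((X ^\<^sub>m k) $$ (r, p))))"
    using Suc.IH[OF Suc.prems(1)] skew_hermitianD[OF S _ Suc.prems(2)] by (intro sum.cong) auto
  also have "\<dots> = (-1) ^ Suc k * cnj (\<Sum>p<N. (X ^\<^sub>m k) $$ (r, p) * X $$ (p, c))"
    by (simp add: sum_distrib_left sum_negf ac_simps)
  also have "(\<Sum>p<N. (X ^\<^sub>m k) $$ (r, p) * X $$ (p, c)) = (X ^\<^sub>m Suc k) $$ (r, c)"
    using Suc.prems by (simp add: index_mult_mat_sum[OF Xk X])
  finally show ?case .
qed

text \<open>
  For skew-Hermitian \<open>X\<close> the adjoint of \<open>exp X\<close> is \<open>exp (- X)\<close>, its inverse.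
\<close>

lemma mat_exp_skew_hermitian_unitary:
  assumes X: "X \<in> carrier_mat N N" and S: "skew_hermitian N X"
  shows "mat_exp X \<in> unitary_group N"
  unfolding unitary_group_iff
proof (intro conjI allI impI)
  have mX: "- X = (-1) \<cdot>\<^sub>m X" "- X \<in> carrier_mat N N" using X by auto
  fix a b assume ab: "a < N" "b < N"
  have "cnj (mat_exp X $$ (p, a)) = mat_exp (- X) $$ (a, p)" if "p < N" for p
  proof -
    have "cnj (mat_exp X $$ (p, a)) = (\<Sum>k. cnj ((X ^\<^sub>m k) $$ (p, a) / fact k))"
      unfolding index_mat_exp[OF X that ab(1)]
      by (intro bounded_linear.suminf[OF bounded_linear_cnj]
          summable_norm_cancel[OF summable_norm_mat_exp[OF X that ab(1)]])
    also have "\<dots> = mat_exp (- X) $$ (a, p)"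
      unfolding index_mat_exp[OF mX(2) ab(1) that] unfolding mX(1)
      using skew_hermitian_pow[OF X S that ab(1)]
      by (intro suminf_cong) (simp add: index_smult_pow_mat[OF X ab(1) that] flip: mult.assoc)
    finally show ?thesis .
  qed
  then have "(\<Sum>p<N. cnj (mat_exp X $$ (p, a)) * mat_exp X $$ (p, b)) =
      (mat_exp (- X) * mat_exp X) $$ (a, b)"
    by (simp add: index_mult_mat_sum[OF mat_exp_carrier[OF mX(2)] mat_exp_carrier[OF X] ab])
  then show "(\<Sum>p<N. cnj (mat_exp X $$ (p, a)) * mat_exp X $$ (p, b)) = 1\<^sub>m N $$ (a, b)"
    by (simp add: mat_exp_uminus_mult[OF X])
qed (use X in simp)

lemma quaternionic_mult:
  assumes A: "A \<in> carrier_mat (2 * n) (2 * n)" and B: "B \<in> carrier_mat (2 * n) (2 * n)"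
    and Q: "quaternionic n A" "quaternionic n B"
  shows "quaternionic n (A * B)"
  unfolding quaternionic_def
proof (intro allI impI)
  fix r c assume rc: "r < 2 * n" "c < 2 * n"
  have "(A * B) $$ (sp_flip n r, sp_flip n c) =
      (\<Sum>p<2 * n. A $$ (sp_flip n r, p) * B $$ (p, sp_flip n c))"
    using rc by (intro index_mult_mat_sum[OF A B]) auto
  also have "\<dots> = (\<Sum>p<2 * n. A $$ (sp_flip n r, sp_flip n p) * B $$ (sp_flip n p, sp_flip n c))"
    by (rule sum_sp_flip[symmetric])
  also have "\<dots> = (\<Sum>p<2 * n. sp_sign n r * sp_sign n c * (cnj (A $$ (r, p)) * cnj (B $$ (p, c))))"
    using Q rc by (intro sum.cong) (auto simp: quaternionic_def ac_simps)
  also have "\<dots> = sp_sign n r * sp_sign n c * cnj ((A * B) $$ (r, c))"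
    by (simp add: index_mult_mat_sum[OF A B rc] sum_distrib_left)
  finally show "(A * B) $$ (sp_flip n r, sp_flip n c) = sp_sign n r * sp_sign n c * cnj ((A * B) $$ (r, c))" .
qed

lemma quaternionic_pow:
  assumes X: "X \<in> carrier_mat (2 * n) (2 * n)" and "quaternionic n X"
  shows "quaternionic n (X ^\<^sub>m k)"
proof (induction k)
  case 0
  then show ?case using X by (auto simp: quaternionic_def sp_flip_eq_iff)
next
  case (Suc k)
  then show ?case using assms by (auto intro!: quaternionic_mult)
qed

lemma quaternionic_mat_exp:
  assumes X: "X \<in> carrier_mat (2 * n) (2 * n)" and Q: "quaternionic n X"
  shows "quaternionic n (mat_exp X)"
  unfolding quaternionic_def
proof (intro allI impI)
  fix r c assume rc: "r < 2 * n" "c < 2 * n"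
  then have f: "sp_flip n r < 2 * n" "sp_flip n c < 2 * n" by simp_all
  have sm: "summable (\<lambda>k. (X ^\<^sub>m k) $$ (r, c) / fact k)"
    by (rule summable_norm_cancel[OF summable_norm_mat_exp[OF X rc]])
  have "mat_exp X $$ (sp_flip n r, sp_flip n c) =
      (\<Sum>k. sp_sign n r * sp_sign n c * cnj ((X ^\<^sub>m k) $$ (r, c) / fact k))"
    unfolding index_mat_exp[OF X f] using quaternionic_pow[OF X Q] rc
    by (intro suminf_cong) (auto simp: quaternionic_def)
  also have "\<dots> = sp_sign n r * sp_sign n c * (\<Sum>k. cnj ((X ^\<^sub>m k) $$ (r, c) / fact k))"
    by (intro suminf_mult bounded_linear.summable[OF bounded_linear_cnj] sm)
  also have "(\<Sum>k. cnj ((X ^\<^sub>m k) $$ (r, c) / fact k)) = cnj (mat_exp X $$ (r, c))"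
    unfolding index_mat_exp[OF X rc]
    by (rule bounded_linear.suminf[OF bounded_linear_cnj sm, symmetric])
  finally show "mat_exp X $$ (sp_flip n r, sp_flip n c) =
      sp_sign n r * sp_sign n c * cnj (mat_exp X $$ (r, c))" .
qed

lemma lie_algebra_Sp_iff:
  "X \<in> lie_algebra (2 * n) (Sp n) \<longleftrightarrow>
    X \<in> carrier_mat (2 * n) (2 * n) \<and> skew_hermitian (2 * n) X \<and> quaternionic n X"
proof (intro iffI conjI)
  assume "X \<in> lie_algebra (2 * n) (Sp n)"
  then have X: "X \<in> carrier_mat (2 * n) (2 * n)"
    and E: "\<And>s. mat_exp (complex_of_real s \<cdot>\<^sub>m X) \<in> unitary_group (2 * n)"
      "\<And>s. quaternionic n (mat_exp (complex_of_real s \<cdot>\<^sub>m X))"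
    by (auto simp: lie_algebra_def Sp_iff)
  from X show "X \<in> carrier_mat (2 * n) (2 * n)" .
  from X E(1) show "skew_hermitian (2 * n) X" by (rule lie_algebra_unitary_imp_skew_hermitian)
  from X E(2) show "quaternionic n X" by (rule lie_algebra_quaternionic_imp_quaternionic)
next
  assume asm: "X \<in> carrier_mat (2 * n) (2 * n) \<and> skew_hermitian (2 * n) X \<and> quaternionic n X"
  then have X: "X \<in> carrier_mat (2 * n) (2 * n)" by blast
  have "mat_exp (complex_of_real s \<cdot>\<^sub>m X) \<in> Sp n" for s
  proof -
    have "skew_hermitian (2 * n) (complex_of_real s \<cdot>\<^sub>m X)"
      unfolding skew_hermitian_def
    proof (intro allI impI)
      fix r c assume rc: "r < 2 * n" "c < 2 * n"
      then show "(complex_of_real s \<cdot>\<^sub>m X) $$ (c, r) = - cnj ((complex_of_real s \<cdot>\<^sub>m X) $$ (r, c))"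
        using X skew_hermitianD[OF conjunct1[OF conjunct2[OF asm]] rc] by auto
    qed
    moreover have "quaternionic n (complex_of_real s \<cdot>\<^sub>m X)"
      using asm X by (auto simp: quaternionic_def)
    ultimately show ?thesis
      using X by (auto simp: Sp_iff intro!: mat_exp_skew_hermitian_unitary quaternionic_mat_exp)
  qed
  with X show "X \<in> lie_algebra (2 * n) (Sp n)" by (simp add: lie_algebra_def)
qed

text \<open>
  On a skew-Hermitian matrix, conjugation of an entry amounts to transposition up to sign. Thus the
  conjugate in the condition of commuting with \<open>J\<close> can be traded for a transposition; the resulting
  relation is complex linear, and it defines \<open>sp(n, \<complex>)\<close>. Conversely, the skew-Hermitian and the Hermitian
  part of a matrix in \<open>sp(n, \<complex>)\<close> belong to \<open>g\<close> and \<open>\<i> g\<close>.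
\<close>

lemma lie_algebra_C_Sp_iff:
  "Z \<in> lie_algebra_C (2 * n) (Sp n) \<longleftrightarrow> Z \<in> carrier_mat (2 * n) (2 * n) \<and>
    (\<forall>r<2 * n. \<forall>c<2 * n. Z $$ (sp_flip n c, sp_flip n r) = - sp_sign n r * sp_sign n c * Z $$ (r, c))"
proof (intro iffI conjI allI impI)
  assume "Z \<in> lie_algebra_C (2 * n) (Sp n)"
  then obtain X Y where Z: "Z = X + \<i> \<cdot>\<^sub>m Y"
    and X: "X \<in> carrier_mat (2 * n) (2 * n)" "skew_hermitian (2 * n) X" "quaternionic n X"
    and Y: "Y \<in> carrier_mat (2 * n) (2 * n)" "skew_hermitian (2 * n) Y" "quaternionic n Y"
    unfolding lie_algebra_C_def lie_algebra_Sp_iff by blast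
  show "Z \<in> carrier_mat (2 * n) (2 * n)" using X Y by (simp add: Z)
  have *: "W $$ (sp_flip n c, sp_flip n r) = - sp_sign n r * sp_sign n c * W $$ (r, c)"
    if "skew_hermitian (2 * n) W" "quaternionic n W" "r < 2 * n" "c < 2 * n" for W r c
  proof -
    have "W $$ (sp_flip n c, sp_flip n r) = sp_sign n c * sp_sign n r * cnj (W $$ (c, r))"
      using that by (simp add: quaternionic_def)
    also have "cnj (W $$ (c, r)) = - W $$ (r, c)"
      using skew_hermitianD[OF that(1,4,3)] by simp
    finally show ?thesis by simp
  qed
  fix r c assume rc: "r < 2 * n" "c < 2 * n"
  then show "Z $$ (sp_flip n c, sp_flip n r) = - sp_sign n r * sp_sign n c * Z $$ (r, c)"
    using X(1) Y(1) *[OF X(2,3) rc] *[OF Y(2,3) rc] by (auto simp: Z distrib_left)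
next
  assume "Z \<in> carrier_mat (2 * n) (2 * n) \<and>
    (\<forall>r<2 * n. \<forall>c<2 * n. Z $$ (sp_flip n c, sp_flip n r) = - sp_sign n r * sp_sign n c * Z $$ (r, c))"
  then have Z: "Z \<in> carrier_mat (2 * n) (2 * n)"
    and S: "\<And>r c. r < 2 * n \<Longrightarrow> c < 2 * n \<Longrightarrow>
      Z $$ (sp_flip n c, sp_flip n r) = - sp_sign n r * sp_sign n c * Z $$ (r, c)" by blast+
  define X where "X = mat (2 * n) (2 * n) (\<lambda>(r, c). (Z $$ (r, c) - cnj (Z $$ (c, r))) / 2)"
  define Y where "Y = mat (2 * n) (2 * n) (\<lambda>(r, c). (Z $$ (r, c) + cnj (Z $$ (c, r))) / (2 * \<i>))"
  have "Z = X + \<i> \<cdot>\<^sub>m Y"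
    using Z by (intro eq_matI) (auto simp: X_def Y_def field_simps)
  moreover have "skew_hermitian (2 * n) X" "skew_hermitian (2 * n) Y"
    by (auto simp: skew_hermitian_def X_def Y_def field_simps)
  moreover have "quaternionic n X" "quaternionic n Y"
    unfolding quaternionic_def X_def Y_def
    by (auto simp: S add_divide_distrib diff_divide_distrib distrib_left right_diff_distrib)
      (simp add: ac_simps)
  moreover have "X \<in> carrier_mat (2 * n) (2 * n)" "Y \<in> carrier_mat (2 * n) (2 * n)"
    by (simp_all add: X_def Y_def)
  ultimately show "Z \<in> lie_algebra_C (2 * n) (Sp n)"
    unfolding lie_algebra_C_def lie_algebra_Sp_iff by blast
qed

section \<open>The torus and its lattices\<close>

text \<open>
  The diagonal of \<open>\<Sum> a\<^sub>i E\<^sub>i\<close> divided by \<open>\<i>\<close>. The value type is left open because both real torus elements and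
  integral ones are used.
\<close>

definition sp_weight :: "nat \<Rightarrow> (nat \<Rightarrow> 'a :: ab_group_add) \<Rightarrow> nat \<Rightarrow> 'a" where
  "sp_weight n a r = (if r < n then a (r + 1) else - a (r + 1 - n))"

lemma sp_weight_flip: "r < 2 * n \<Longrightarrow> sp_weight n a (sp_flip n r) = - sp_weight n a r"
  by (auto simp: sp_weight_def sp_flip_def Suc_diff_le)

text \<open>
  Both the coordinate read off and its sign are independent of \<open>a\<close>; hence one case distinction treats the
  weights of two torus elements simultaneously.
\<close>

lemma sp_weight_cases:
  assumes "r < 2 * n"
  obtains i where "i \<in> {1..n}" "\<And>a :: nat \<Rightarrow> 'a :: ab_group_add. sp_weight n a r = a i"
  | i where "i \<in> {1..n}" "\<And>a :: nat \<Rightarrow> 'a :: ab_group_add. sp_weight n a r = - a i"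
proof (cases "r < n")
  case True
  then have "r + 1 \<in> {1..n}" by simp
  then show ?thesis by (rule that(1)) (simp add: sp_weight_def True)
next
  case False
  then have "r + 1 - n \<in> {1..n}" using assms by auto
  then show ?thesis by (rule that(2)) (simp add: sp_weight_def False)
qed

definition torus_element :: "nat \<Rightarrow> (nat \<Rightarrow> real) \<Rightarrow> complex mat" where
  "torus_element n a = mat_diag (2 * n) (\<lambda>r. \<i> * of_real (sp_weight n a r))"

lemma torus_element_carrier [simp]: "torus_element n a \<in> carrier_mat (2 * n) (2 * n)"
  by (simp add: torus_element_def)

lemma finsum_sp_E:
  "(\<Oplus>\<^bsub>module_mat TYPE(complex) (2 * n) (2 * n)\<^esub>i\<in>{1..n}. complex_of_real (a i) \<cdot>\<^sub>m sp_E n i) =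
    torus_element n a" (is "?S = _")
proof (rule eq_matI)
  have S: "?S \<in> carrier_mat (2 * n) (2 * n)" by (intro finsum_mat_closed) auto
  then show "dim_row ?S = dim_row (torus_element n a)" "dim_col ?S = dim_col (torus_element n a)"
    by (auto simp: torus_element_def mat_diag_def)
  fix r c assume "r < dim_row (torus_element n a)" "c < dim_col (torus_element n a)"
  then have rc: "r < 2 * n" "c < 2 * n" by (simp_all add: torus_element_def mat_diag_def)
  have "?S $$ (r, c) = (\<Sum>i\<in>{1..n}. (complex_of_real (a i) \<cdot>\<^sub>m sp_E n i) $$ (r, c))"
    using rc by (intro index_finsum_mat) auto
  also have "\<dots> = (\<Sum>i\<in>{1..n}. if i = (if r < n then r + 1 else r + 1 - n)
      then torus_element n a $$ (r, c) else 0)"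
  proof (intro sum.cong refl)
    fix i assume "i \<in> {1..n}"
    then have i: "1 \<le> i" "i \<le> n" by simp_all
    have upper: "r + 1 = i \<longleftrightarrow> r < n \<and> i = r + 1" using i by linarith
    have lower: "r + 1 = n + i \<longleftrightarrow> \<not> r < n \<and> i = r + 1 - n" using i by linarith
    have E: "sp_E n i $$ (r, c) = (if r = c \<and> r < n \<and> i = r + 1 then \<i>
        else if r = c \<and> \<not> r < n \<and> i = r + 1 - n then - \<i> else 0)"
      unfolding sp_E_def using rc by (simp only: index_mat prod.case upper lower)
    have "(complex_of_real (a i) \<cdot>\<^sub>m sp_E n i) $$ (r, c) = complex_of_real (a i) * sp_E n i $$ (r, c)"
      using rc by (simp add: sp_E_def)
    also have "\<dots> = (if i = (if r < n then r + 1 else r + 1 - n) then torus_element n a $$ (r, c) else 0)"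
      unfolding E torus_element_def mat_diag_def sp_weight_def using rc
      by (cases "r < n"; cases "r = c") simp_all
    finally show "(complex_of_real (a i) \<cdot>\<^sub>m sp_E n i) $$ (r, c) = \<dots>" .
  qed
  also have "\<dots> = torus_element n a $$ (r, c)"
  proof -
    have "(if r < n then r + 1 else r + 1 - n) \<in> {1..n}" using rc by auto
    then show ?thesis by (simp only: sum.delta finite_atLeastAtMost if_True)
  qed
  finally show "?S $$ (r, c) = torus_element n a $$ (r, c)" .
qed

lemma sp_torus_eq: "sp_torus n = range (torus_element n)"
  unfolding sp_torus_def finsum_sp_E by auto

lemma torus_element_eq_iff:
  "torus_element n a = torus_element n b \<longleftrightarrow> (\<forall>i\<in>{1..n}. a i = b i)"
proof
  assume eq: "torus_element n a = torus_element n b"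
  show "\<forall>i\<in>{1..n}. a i = b i"
  proof
    fix i assume "i \<in> {1..n}"
    then obtain k where "i = Suc k" "k < n" by (cases i) auto
    then show "a i = b i"
      using arg_cong[OF eq, of "\<lambda>X. X $$ (k, k)"]
      by (simp add: torus_element_def mat_diag_def sp_weight_def)
  qed
next
  assume eq: "\<forall>i\<in>{1..n}. a i = b i"
  have "sp_weight n a r = sp_weight n b r" if "r < 2 * n" for r
    using that by (cases rule: sp_weight_cases[where 'a = real]) (use eq in auto)
  then show "torus_element n a = torus_element n b"
    by (auto simp: torus_element_def mat_diag_def intro!: cong_mat)
qed

text \<open>
  The factor \<open>t\<close> serves both lattices at once: \<open>t = 1\<close> for the integral one, \<open>t = 1/2\<close> for \<open>\<II>\<^sup>2\<close>.
\<close>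

lemma mat_exp_torus_element:
  "mat_exp (of_real (2 * pi * t) \<cdot>\<^sub>m torus_element n a) = 1\<^sub>m (2 * n) \<longleftrightarrow>
    (\<forall>i\<in>{1..n}. t * a i \<in> \<int>)"
proof -
  have exp_1: "exp (complex_of_real (2 * pi * x) * \<i>) = 1 \<longleftrightarrow> x \<in> \<int>" for x
  proof -
    have "exp (complex_of_real (2 * pi * x) * \<i>) = cis (2 * pi * x)"
      by (simp add: cis_conv_exp mult.commute)
    also have "\<dots> = 1 \<longleftrightarrow> cos (2 * pi * x) = 1"
      by (auto simp: complex_eq_iff intro: cos_one_sin_zero)
    also have "\<dots> \<longleftrightarrow> x \<in> \<int>"
      by (auto simp: cos_one_2pi_int Ints_def)
    finally show ?thesis .
  qed
  let ?e = "\<lambda>r. exp (complex_of_real (2 * pi * (t * sp_weight n a r)) * \<i>)"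
  have "of_real (2 * pi * t) \<cdot>\<^sub>m torus_element n a =
      mat_diag (2 * n) (\<lambda>r. of_real (2 * pi * (t * sp_weight n a r)) * \<i>)"
    by (auto simp: torus_element_def mat_diag_def)
  then have "mat_exp (of_real (2 * pi * t) \<cdot>\<^sub>m torus_element n a) = mat_diag (2 * n) ?e"
    by (simp only: mat_exp_diag)
  also have "\<dots> = 1\<^sub>m (2 * n) \<longleftrightarrow> (\<forall>r<2 * n. ?e r = 1)"
  proof
    assume eq: "mat_diag (2 * n) ?e = 1\<^sub>m (2 * n)"
    show "\<forall>r<2 * n. ?e r = 1"
    proof (intro allI impI)
      fix r assume "r < 2 * n"
      then show "?e r = 1" using arg_cong[OF eq, of "\<lambda>X. X $$ (r, r)"]
        by (simp add: mat_diag_def)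
    qed
  qed (auto simp: mat_diag_def)
  also have "\<dots> \<longleftrightarrow> (\<forall>r<2 * n. t * sp_weight n a r \<in> \<int>)"
    by (simp only: exp_1)
  also have "\<dots> \<longleftrightarrow> (\<forall>i\<in>{1..n}. t * a i \<in> \<int>)"
  proof
    assume L: "\<forall>r<2 * n. t * sp_weight n a r \<in> \<int>"
    show "\<forall>i\<in>{1..n}. t * a i \<in> \<int>"
    proof
      fix i assume "i \<in> {1..n}"
      then obtain k where "i = Suc k" "k < n" by (cases i) auto
      then show "t * a i \<in> \<int>" using L[rule_format, of k] by (simp add: sp_weight_def)
    qed
  next
    assume R: "\<forall>i\<in>{1..n}. t * a i \<in> \<int>"
    show "\<forall>r<2 * n. t * sp_weight n a r \<in> \<int>"
    proof (intro allI impI)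
      fix r assume "r < 2 * n"
      then show "t * sp_weight n a r \<in> \<int>"
        by (cases rule: sp_weight_cases[where 'a = real]) (use R in auto)
    qed
  qed
  finally show ?thesis .
qed

lemma torus_element_in_int_lattice_iff:
  "torus_element n a \<in> int_lattice (2 * n) (sp_torus n) \<longleftrightarrow> (\<forall>i\<in>{1..n}. a i \<in> \<int>)"
  using mat_exp_torus_element[of 1 n a] by (auto simp: int_lattice_def sp_torus_eq)

lemma torus_element_in_square_lattice_iff:
  "torus_element n a \<in> square_lattice (2 * n) (sp_torus n) \<longleftrightarrow> (\<forall>i\<in>{1..n}. a i / 2 \<in> \<int>)"
  using mat_exp_torus_element[of "1/2" n a] by (auto simp: square_lattice_def sp_torus_eq)

lemma torus_element_diff: "torus_element n a - torus_element n b = torus_element n (\<lambda>i. a i - b i)"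
  by (auto simp: torus_element_def mat_diag_def sp_weight_def algebra_simps)

lemma sp_L_torus_element: "i \<in> {1..n} \<Longrightarrow> sp_L i (torus_element n a) = \<i> * of_real (a i)"
  using sp_L_torus[of i n a] unfolding finsum_sp_E .

section \<open>The subspaces \<open>\<pp>\<^sub>i\<close> and the order \<open>\<preceq>\<close>\<close>

lemma carrier_mat_eq_iff:
  "A \<in> carrier_mat N M \<Longrightarrow> B \<in> carrier_mat N M \<Longrightarrow>
    A = B \<longleftrightarrow> (\<forall>r<N. \<forall>c<M. A $$ (r, c) = B $$ (r, c))"
  by (auto intro!: eq_matI)

lemma index_commutator_mat_diag:
  fixes X :: "complex mat"
  assumes X: "X \<in> carrier_mat N N" and "r < N" "c < N"
  shows "(mat_diag N f * X - X * mat_diag N f) $$ (r, c) = (f r - f c) * X $$ (r, c)"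
  using assms by (simp add: mat_diag_mult_left[OF X] mat_diag_mult_right[OF X] algebra_simps)

text \<open>
  The operator \<open>ad \<xi>\<close> is diagonal in the matrix units, with eigenvalue \<open>\<i> (w\<^sub>r - w\<^sub>c)\<close> at the entry
  \<open>(r, c)\<close>.
\<close>

lemma ad_eigenspace_mat_diag:
  "ad_eigenspace N G (mat_diag N (\<lambda>r. \<i> * of_int (w r))) j =
    {X \<in> lie_algebra_C N G. \<forall>r<N. \<forall>c<N. X $$ (r, c) \<noteq> 0 \<longrightarrow> w r - w c = j}"
  (is "ad_eigenspace N G ?\<xi> j = _")
proof -
  have "?\<xi> * X - X * ?\<xi> = (\<i> * of_int j) \<cdot>\<^sub>m X \<longleftrightarrow>
      (\<forall>r<N. \<forall>c<N. X $$ (r, c) \<noteq> 0 \<longrightarrow> w r - w c = j)"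
    if "X \<in> lie_algebra_C N G" for X
  proof -
    have X: "X \<in> carrier_mat N N"
      using that by (auto simp: lie_algebra_C_def lie_algebra_def)
    have M: "?\<xi> * X - X * ?\<xi> \<in> carrier_mat N N"
      by (intro minus_carrier_mat mult_carrier_mat[OF X mat_diag_dim])
    have "?\<xi> * X - X * ?\<xi> = (\<i> * of_int j) \<cdot>\<^sub>m X \<longleftrightarrow>
        (\<forall>r<N. \<forall>c<N. (?\<xi> * X - X * ?\<xi>) $$ (r, c) = ((\<i> * of_int j) \<cdot>\<^sub>m X) $$ (r, c))"
      using X by (intro carrier_mat_eq_iff[OF M]) simp
    also have "\<dots> \<longleftrightarrow> (\<forall>r<N. \<forall>c<N. (\<i> * of_int (w r) - \<i> * of_int (w c)) * X $$ (r, c) =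
        \<i> * of_int j * X $$ (r, c))"
      using X by (auto simp: index_commutator_mat_diag[OF X] simp del: index_minus_mat)
    also have "\<dots> \<longleftrightarrow> (\<forall>r<N. \<forall>c<N. X $$ (r, c) \<noteq> 0 \<longrightarrow> w r - w c = j)"
      by (auto simp flip: right_diff_distrib of_int_diff)
    finally show ?thesis .
  qed
  then show ?thesis by (auto simp: ad_eigenspace_def)
qed

text \<open>
  The point is that a matrix of the complexified Lie algebra can be split by weight inside this algebra.
  The defining relation links the entry \<open>(r, c)\<close> with the flipped and transposed one; both have the
  weight \<open>w\<^sub>r - w\<^sub>c\<close> because \<open>w\<close> is odd under the flip, so erasing all entries of other weights preserves it.
\<close>

lemma parab_Sp:
  assumes w: "\<forall>r<2 * n. w (sp_flip n r) = - w r"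
  shows "parab (2 * n) (Sp n) (mat_diag (2 * n) (\<lambda>r. \<i> * of_int (w r))) k =
    {Z \<in> lie_algebra_C (2 * n) (Sp n). \<forall>r<2 * n. \<forall>c<2 * n. Z $$ (r, c) \<noteq> 0 \<longrightarrow> w r - w c \<le> k}"
    (is "parab _ _ ?\<xi> k = ?R")
proof (intro Set.equalityI subsetI)
  fix Z assume "Z \<in> parab (2 * n) (Sp n) ?\<xi> k"
  then obtain S Y where Z: "Z = (\<Oplus>\<^bsub>module_mat TYPE(complex) (2 * n) (2 * n)\<^esub>j\<in>S. Y j)"
    and S: "finite S" "S \<subseteq> {..k}"
    and Y: "\<And>j. j \<in> S \<Longrightarrow> Y j \<in> ad_eigenspace (2 * n) (Sp n) ?\<xi> j"
    unfolding parab_def by blast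
  have YL: "Y j \<in> lie_algebra_C (2 * n) (Sp n)"
    and Yw: "\<And>r c. r < 2 * n \<Longrightarrow> c < 2 * n \<Longrightarrow> Y j $$ (r, c) \<noteq> 0 \<Longrightarrow> w r - w c = j"
    if "j \<in> S" for j using Y[OF that] by (auto simp: ad_eigenspace_mat_diag)
  have Yc: "Y j \<in> carrier_mat (2 * n) (2 * n)" if "j \<in> S" for j
    using YL[OF that] by (simp add: lie_algebra_C_Sp_iff)
  have Zi: "Z $$ (r, c) = (\<Sum>j\<in>S. Y j $$ (r, c))" if "r < 2 * n" "c < 2 * n" for r c
    unfolding Z using S Yc that by (intro index_finsum_mat) auto
  have "Z \<in> lie_algebra_C (2 * n) (Sp n)" unfolding lie_algebra_C_Sp_iff
  proof (intro conjI allI impI)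
    show "Z \<in> carrier_mat (2 * n) (2 * n)" unfolding Z using S Yc by (intro finsum_mat_closed)
    fix r c assume rc: "r < 2 * n" "c < 2 * n"
    have "Z $$ (sp_flip n c, sp_flip n r) = (\<Sum>j\<in>S. Y j $$ (sp_flip n c, sp_flip n r))"
      using rc by (intro Zi) auto
    also have "\<dots> = (\<Sum>j\<in>S. - sp_sign n r * sp_sign n c * Y j $$ (r, c))"
      using YL rc by (intro sum.cong refl) (simp add: lie_algebra_C_Sp_iff)
    also have "\<dots> = - sp_sign n r * sp_sign n c * Z $$ (r, c)"
      unfolding Zi[OF rc] by (rule sum_distrib_left[symmetric])
    finally show "Z $$ (sp_flip n c, sp_flip n r) = - sp_sign n r * sp_sign n c * Z $$ (r, c)" .
  qed
  moreover have "w r - w c \<le> k" if rc: "r < 2 * n" "c < 2 * n" and nz: "Z $$ (r, c) \<noteq> 0" for r c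
  proof -
    from nz obtain j where j: "j \<in> S" "Y j $$ (r, c) \<noteq> 0"
      unfolding Zi[OF rc] by (rule sum.not_neutral_contains_not_neutral)
    from Yw[OF j(1) rc j(2)] j(1) S(2) show ?thesis by auto
  qed
  ultimately show "Z \<in> ?R" by blast
next
  fix Z assume "Z \<in> ?R"
  then have ZL: "Z \<in> lie_algebra_C (2 * n) (Sp n)"
    and Zw: "\<And>r c. r < 2 * n \<Longrightarrow> c < 2 * n \<Longrightarrow> Z $$ (r, c) \<noteq> 0 \<Longrightarrow> w r - w c \<le> k" by blast+
  have Zc: "Z \<in> carrier_mat (2 * n) (2 * n)" using ZL by (simp add: lie_algebra_C_Sp_iff)
  \<comment> \<open>only the finitely many weights that occur can contribute\<close>
  define S where "S = (\<lambda>(r, c). w r - w c) ` ({..<2 * n} \<times> {..<2 * n}) \<inter> {..k}"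
  define Y where "Y = (\<lambda>j. mat (2 * n) (2 * n) (\<lambda>(r, c). if w r - w c = j then Z $$ (r, c) else 0))"
  have S: "finite S" "S \<subseteq> {..k}" unfolding S_def by auto
  have YE: "Y j \<in> ad_eigenspace (2 * n) (Sp n) ?\<xi> j" for j
  proof -
    have "Y j \<in> lie_algebra_C (2 * n) (Sp n)"
      using ZL w by (auto simp: lie_algebra_C_Sp_iff Y_def)
    then show ?thesis by (auto simp: ad_eigenspace_mat_diag Y_def split: if_splits)
  qed
  have Yc: "Y j \<in> carrier_mat (2 * n) (2 * n)" for j by (simp add: Y_def)
  let ?F = "(\<Oplus>\<^bsub>module_mat TYPE(complex) (2 * n) (2 * n)\<^esub>j\<in>S. Y j)"
  have F: "?F \<in> carrier_mat (2 * n) (2 * n)" using S Yc by (intro finsum_mat_closed)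
  have "Z = ?F"
  proof (rule eq_matI)
    fix r c assume "r < dim_row ?F" "c < dim_col ?F"
    then have rc: "r < 2 * n" "c < 2 * n" using F by auto
    have "?F $$ (r, c) = (\<Sum>j\<in>S. Y j $$ (r, c))"
      using S Yc rc by (intro index_finsum_mat) auto
    also have "\<dots> = (\<Sum>j\<in>S. if j = w r - w c then Z $$ (r, c) else 0)"
      using rc by (intro sum.cong) (auto simp: Y_def)
    also have "\<dots> = (if w r - w c \<in> S then Z $$ (r, c) else 0)"
      using S by simp
    also have "\<dots> = Z $$ (r, c)"
      using Zw[OF rc] rc by (auto simp: S_def)
    finally show "Z $$ (r, c) = ?F $$ (r, c)" ..
  qed (use F Zc in auto)
  with S YE show "Z \<in> parab (2 * n) (Sp n) ?\<xi> k" unfolding parab_def by blast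
qed

text \<open>
  For the forward direction, every entry \<open>(r, c)\<close> is nonzero in some element of \<open>sp(n, \<complex>)\<close> of pure
  weight, namely a root vector (or, if \<open>r = c\<close>, an element of the Cartan subalgebra). It lies in \<open>\<pp>\<^sub>i\<close>
  for \<open>i\<close> the larger of zero and its weight; the maximum with zero reflects that only \<open>i \<ge> 0\<close> is tested.
\<close>

lemma prec_Sp_iff_weights:
  assumes w: "\<forall>r<2 * n. w (sp_flip n r) = - w r"
    and v: "\<forall>r<2 * n. v (sp_flip n r) = - v r"
  shows "prec (2 * n) (Sp n) (mat_diag (2 * n) (\<lambda>r. \<i> * of_int (w r)))
      (mat_diag (2 * n) (\<lambda>r. \<i> * of_int (v r))) \<longleftrightarrow>
    (\<forall>r<2 * n. \<forall>c<2 * n. v r - v c \<le> max 0 (w r - w c))"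
proof
  assume P: "prec (2 * n) (Sp n) (mat_diag (2 * n) (\<lambda>r. \<i> * of_int (w r)))
      (mat_diag (2 * n) (\<lambda>r. \<i> * of_int (v r)))"
  show "\<forall>r<2 * n. \<forall>c<2 * n. v r - v c \<le> max 0 (w r - w c)"
  proof (intro allI impI)
    fix r c assume rc: "r < 2 * n" "c < 2 * n"
    define Z where "Z = mat (2 * n) (2 * n) (\<lambda>(p, q). (if p = r \<and> q = c then 1 else 0) -
      sp_sign n r * sp_sign n c * (if p = sp_flip n c \<and> q = sp_flip n r then 1 else 0))"
    have ZL: "Z \<in> lie_algebra_C (2 * n) (Sp n)"
      unfolding lie_algebra_C_Sp_iff
    proof (intro conjI allI impI)
      fix p q assume pq: "p < 2 * n" "q < 2 * n"
      show "Z $$ (sp_flip n q, sp_flip n p) = - sp_sign n p * sp_sign n q * Z $$ (p, q)"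
      proof -
        let ?A = "p = r \<and> q = c" and ?B = "p = sp_flip n c \<and> q = sp_flip n r"
        have A: "sp_flip n q = sp_flip n c \<and> sp_flip n p = sp_flip n r \<longleftrightarrow> ?A"
          using rc pq by (metis sp_flip_flip)
        have B: "sp_flip n q = r \<and> sp_flip n p = c \<longleftrightarrow> ?B"
          using rc pq by (metis sp_flip_flip)
        have "Z $$ (sp_flip n q, sp_flip n p) =
            (if ?B then 1 else 0) - sp_sign n r * sp_sign n c * (if ?A then 1 else 0)"
          using pq by (simp add: Z_def A B)
        also have "sp_sign n r * sp_sign n c * (if ?A then 1 else 0) =
            sp_sign n p * sp_sign n q * (if ?A then 1 else 0)" by simp
        also have "(if ?B then 1 else 0) =
            sp_sign n p * sp_sign n q * (sp_sign n r * sp_sign n c * (if ?B then 1 else 0))"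
          using rc by (simp add: mult.left_commute)
        also have "\<dots> - sp_sign n p * sp_sign n q * (if ?A then 1 else 0) =
            - sp_sign n p * sp_sign n q * Z $$ (p, q)"
          using pq by (simp add: Z_def right_diff_distrib)
        finally show ?thesis .
      qed
    qed (simp add: Z_def)
    \<comment> \<open>if the two matrix units coincide (a long root), the coefficient is two, not zero\<close>
    have nz: "Z $$ (r, c) \<noteq> 0"
    proof (cases "r = sp_flip n c")
      case True
      then show ?thesis using rc by (simp add: Z_def)
    next
      case False
      then show ?thesis using rc by (simp add: Z_def)
    qed
    have "Z \<in> parab (2 * n) (Sp n) (mat_diag (2 * n) (\<lambda>r. \<i> * of_int (w r))) (max 0 (w r - w c))"
      unfolding parab_Sp[OF w]
    proof (intro CollectI conjI ZL allI impI)
      fix p q assume "p < 2 * n" "q < 2 * n" "Z $$ (p, q) \<noteq> 0"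
      then have "p = r \<and> q = c \<or> p = sp_flip n c \<and> q = sp_flip n r"
        unfolding Z_def by (simp split: if_splits)
      then show "w p - w q \<le> max 0 (w r - w c)" using w rc by auto
    qed
    then have "Z \<in> parab (2 * n) (Sp n) (mat_diag (2 * n) (\<lambda>r. \<i> * of_int (v r))) (max 0 (w r - w c))"
      using P unfolding prec_def by (meson max.cobounded1 subsetD)
    with nz rc show "v r - v c \<le> max 0 (w r - w c)" by (auto simp: parab_Sp[OF v])
  qed
next
  assume "\<forall>r<2 * n. \<forall>c<2 * n. v r - v c \<le> max 0 (w r - w c)"
  then have "v r - v c \<le> k" if "r < 2 * n" "c < 2 * n" "w r - w c \<le> k" "0 \<le> k" for r c k
    using that by (intro order_trans[of "v r - v c" "max 0 (w r - w c)" k]) auto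
  then show "prec (2 * n) (Sp n) (mat_diag (2 * n) (\<lambda>r. \<i> * of_int (w r)))
      (mat_diag (2 * n) (\<lambda>r. \<i> * of_int (v r)))"
    unfolding prec_def by (auto simp: parab_Sp[OF w] parab_Sp[OF v])
qed

section \<open>Dominant integral elements and the maximal ones among them\<close>

text \<open>
  This is \<open>m\<^sub>1 H\<^sub>1 + \<dots> + m\<^bsub>n-1\<^esub> H\<^bsub>n-1\<^esub> + 2 m\<^sub>n H\<^sub>n\<close>: in the coordinates \<open>a\<^sub>i\<close> with respect to the \<open>E\<^sub>i\<close>, the element
  \<open>H\<^sub>j\<close> contributes to the first \<open>j\<close> of them, which makes them tail sums of \<open>m\<close>. The factor two compensates
  for the entries \<open>1/2\<close> of \<open>H\<^sub>n\<close> and makes integrality automatic.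
\<close>

definition dominant_element :: "nat \<Rightarrow> (nat \<Rightarrow> nat) \<Rightarrow> complex mat" where
  "dominant_element n m = torus_element n (\<lambda>i. real (\<Sum>j\<in>{i..n}. m j))"

lemma dominant_element_eq_mat_diag:
  "dominant_element n m =
    mat_diag (2 * n) (\<lambda>r. \<i> * of_int (sp_weight n (\<lambda>i. int (\<Sum>j\<in>{i..n}. m j)) r))"
proof -
  have "sp_weight n (\<lambda>i. real (\<Sum>j\<in>{i..n}. m j)) r =
      of_int (sp_weight n (\<lambda>i. int (\<Sum>j\<in>{i..n}. m j)) r)" for r
    by (simp add: sp_weight_def)
  then show ?thesis by (simp add: dominant_element_def torus_element_def)
qed

text \<open>
  The passage between \<open>m\<close> and its tail sums is unimodular. The case \<open>d = 0\<close> yields equality of all terms,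
  the case \<open>d = 2\<close> equality of all parities.
\<close>

lemma tail_sums_dvd_iff:
  fixes t :: "nat \<Rightarrow> int"
  shows "(\<forall>i\<in>{1..n}. d dvd (\<Sum>j\<in>{i..n}. t j)) \<longleftrightarrow> (\<forall>j\<in>{1..n}. d dvd t j)"
proof
  assume L: "\<forall>i\<in>{1..n}. d dvd (\<Sum>j\<in>{i..n}. t j)"
  show "\<forall>j\<in>{1..n}. d dvd t j"
  proof
    fix j assume j: "j \<in> {1..n}"
    have "d dvd (\<Sum>k\<in>{Suc j..n}. t k)"
      using L by (cases "j = n") auto
    moreover have "(\<Sum>k\<in>{j..n}. t k) = t j + (\<Sum>k\<in>{Suc j..n}. t k)"
      using j by (intro sum.atLeast_Suc_atMost) simp
    ultimately show "d dvd t j" using L j by (metis dvd_add_left_iff)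
  qed
qed (auto intro!: dvd_sum)

lemma dominant_element_eq_iff:
  "dominant_element n m = dominant_element n m' \<longleftrightarrow> (\<forall>j\<in>{1..n}. m j = m' j)"
proof -
  have "dominant_element n m = dominant_element n m' \<longleftrightarrow>
      (\<forall>i\<in>{1..n}. (\<Sum>j\<in>{i..n}. m j) = (\<Sum>j\<in>{i..n}. m' j))"
    unfolding dominant_element_def torus_element_eq_iff of_nat_eq_iff ..
  also have "\<dots> \<longleftrightarrow> (\<forall>i\<in>{1..n}. 0 dvd (\<Sum>j\<in>{i..n}. int (m j) - int (m' j)))"
    by (simp add: sum_subtractf flip: of_nat_sum)
  also have "\<dots> \<longleftrightarrow> (\<forall>j\<in>{1..n}. m j = m' j)"
    unfolding tail_sums_dvd_iff by simp
  finally show ?thesis .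
qed

lemma half_of_int_in_Ints_iff: "real_of_int x / 2 \<in> \<int> \<longleftrightarrow> even x"
proof
  assume "real_of_int x / 2 \<in> \<int>"
  then obtain k where "real_of_int x / 2 = of_int k" by (auto elim: Ints_cases)
  then have "real_of_int x = of_int (2 * k)" by simp
  then show "even x" by (simp only: of_int_eq_iff) simp
qed (auto elim!: evenE)

lemma dominant_element_diff_in_square_lattice_iff:
  "dominant_element n m - dominant_element n m' \<in> square_lattice (2 * n) (sp_torus n) \<longleftrightarrow>
    (\<forall>j\<in>{1..n}. even (m j) = even (m' j))"
proof -
  let ?t = "\<lambda>j. int (m j) - int (m' j)"
  have "real (\<Sum>j\<in>{i..n}. m j) - real (\<Sum>j\<in>{i..n}. m' j) = of_int (\<Sum>j\<in>{i..n}. ?t j)" for i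
    by (simp add: sum_subtractf)
  then have "dominant_element n m - dominant_element n m' \<in> square_lattice (2 * n) (sp_torus n) \<longleftrightarrow>
      (\<forall>i\<in>{1..n}. even (\<Sum>j\<in>{i..n}. ?t j))"
    unfolding dominant_element_def torus_element_diff torus_element_in_square_lattice_iff
    by (simp only: half_of_int_in_Ints_iff)
  also have "\<dots> \<longleftrightarrow> (\<forall>j\<in>{1..n}. even (m j) = even (m' j))"
    unfolding tail_sums_dvd_iff by simp
  finally show ?thesis .
qed

text \<open>
  For the first inclusion, the simple roots \<open>L\<^sub>j - L\<^bsub>j+1\<^esub>\<close> and \<open>2 L\<^sub>n\<close> show that the successive differences of the
  coordinates are nonnegative. Conversely, tail sums of natural numbers are nonnegative and decreasing.
\<close>

lemma dominant_lattice_Sp: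
  "dominant_lattice (2 * n) (sp_torus n) (sp_pos_roots n) = range (dominant_element n)"
proof (intro Set.equalityI subsetI)
  fix \<xi> assume \<xi>: "\<xi> \<in> dominant_lattice (2 * n) (sp_torus n) (sp_pos_roots n)"
  then have "\<xi> \<in> int_lattice (2 * n) (sp_torus n)" by (simp add: dominant_lattice_def)
  moreover from this obtain a where a: "\<xi> = torus_element n a"
    by (auto simp: int_lattice_def sp_torus_eq)
  ultimately have a_int: "\<And>i. i \<in> {1..n} \<Longrightarrow> a i \<in> \<int>"
    by (simp add: torus_element_in_int_lattice_iff)
  have nonneg: "0 \<le> x" if "\<alpha> \<in> sp_pos_roots n" "\<alpha> \<xi> = \<i> * complex_of_real x" for \<alpha> x
  proof -
    have "0 \<le> \<alpha> \<xi> / \<i>" using \<xi> that(1) by (simp add: dominant_lattice_def)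
    then show ?thesis unfolding that(2) by (simp add: less_eq_complex_def)
  qed
  \<comment> \<open>the successive differences, with the convention that the coordinate after the last is zero\<close>
  define s where "s j = a j - (if j < n then a (j + 1) else 0)" for j
  have s_nonneg: "0 \<le> s j" if j: "j \<in> {1..n}" for j
  proof (cases "j < n")
    case True
    then have "(\<lambda>X. sp_L j X - sp_L (j + 1) X) \<in> sp_pos_roots n"
      using j unfolding sp_pos_roots_def by (intro UnI2 CollectI exI[of _ j] exI[of _ "j + 1"]) auto
    moreover have "sp_L j \<xi> - sp_L (j + 1) \<xi> = \<i> * complex_of_real (s j)"
      using True j by (simp add: a sp_L_torus_element s_def right_diff_distrib)
    ultimately show ?thesis by (rule nonneg)
  next
    case False
    then have "j = n" using j by simp
    then have "(\<lambda>X. sp_L n X + sp_L n X) \<in> sp_pos_roots n"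
      using j unfolding sp_pos_roots_def by (intro UnI1 CollectI exI[of _ n]) auto
    moreover have "sp_L n \<xi> + sp_L n \<xi> = \<i> * complex_of_real (2 * s j)"
      using \<open>j = n\<close> j by (simp add: a sp_L_torus_element s_def)
    ultimately have "0 \<le> 2 * s j" by (rule nonneg)
    then show ?thesis by simp
  qed
  have s_nat: "real (nat \<lfloor>s j\<rfloor>) = s j" if j: "j \<in> {1..n}" for j
  proof -
    have "s j \<in> \<int>" using a_int j by (auto simp: s_def)
    then show ?thesis using s_nonneg[OF j] by (auto elim!: Ints_cases)
  qed
  have "real (\<Sum>j\<in>{i..n}. nat \<lfloor>s j\<rfloor>) = a i" if "i \<in> {1..n}" for i
  proof -
    have "i \<le> n" using that by simp
    then have "1 \<le> i \<Longrightarrow> (\<Sum>j\<in>{i..n}. s j) = a i"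
    proof (induction rule: inc_induct)
      case (step k)
      then show ?case by (simp add: sum.atLeast_Suc_atMost[of k n]) (simp add: s_def)
    qed (simp add: s_def)
    moreover have "real (\<Sum>j\<in>{i..n}. nat \<lfloor>s j\<rfloor>) = (\<Sum>j\<in>{i..n}. s j)"
      unfolding of_nat_sum using s_nat that by (intro sum.cong) auto
    ultimately show ?thesis using that by simp
  qed
  then have "\<xi> = dominant_element n (\<lambda>j. nat \<lfloor>s j\<rfloor>)"
    unfolding a dominant_element_def torus_element_eq_iff by simp
  then show "\<xi> \<in> range (dominant_element n)" by blast
next
  fix \<xi> assume "\<xi> \<in> range (dominant_element n)"
  then obtain m where \<xi>: "\<xi> = dominant_element n m" by blast
  let ?a = "\<lambda>i. real (\<Sum>j\<in>{i..n}. m j)"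
  have "\<xi> \<in> int_lattice (2 * n) (sp_torus n)"
    unfolding \<xi> dominant_element_def torus_element_in_int_lattice_iff
    by (intro ballI Ints_of_nat)
  moreover have "0 \<le> \<alpha> \<xi> / \<i>" if "\<alpha> \<in> sp_pos_roots n" for \<alpha>
  proof -
    have L: "sp_L i \<xi> = \<i> * of_real (?a i)" if "i \<in> {1..n}" for i
      unfolding \<xi> dominant_element_def by (rule sp_L_torus_element[OF that])
    have anti: "?a j \<le> ?a i" if "i \<le> j" for i j
      using that by (intro of_nat_mono sum_mono2) auto
    have "\<exists>x\<ge>0. \<alpha> \<xi> = \<i> * complex_of_real x"
      using that unfolding sp_pos_roots_def
    proof (elim UnE CollectE exE conjE)
      fix i j assume "\<alpha> = (\<lambda>X. sp_L i X + sp_L j X)" "1 \<le> i" "i \<le> j" "j \<le> n"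
      then show ?thesis by (intro exI[of _ "?a i + ?a j"]) (simp add: L distrib_left add_nonneg_nonneg del: of_nat_sum)
    next
      fix i j assume "\<alpha> = (\<lambda>X. sp_L i X - sp_L j X)" "1 \<le> i" "i < j" "j \<le> n"
      then show ?thesis using anti[of i j]
        by (intro exI[of _ "?a i - ?a j"]) (simp add: L right_diff_distrib del: of_nat_sum)
    qed
    then show ?thesis by (auto simp: less_eq_complex_def)
  qed
  ultimately show "\<xi> \<in> dominant_lattice (2 * n) (sp_torus n) (sp_pos_roots n)"
    by (simp add: dominant_lattice_def)
qed

text \<open>
  The simple roots give the forward direction. Conversely, every positive root is
  at the element \<open>\<i>\<close> times a nonnegative combination of the \<open>m\<^sub>j\<close>, and the negative roots stay below zero, where the
  maximum absorbs them.
\<close>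

lemma prec_dominant_element_iff:
  "prec (2 * n) (Sp n) (dominant_element n m) (dominant_element n m') \<longleftrightarrow>
    (\<forall>j\<in>{1..n}. m' j \<le> m j)"
proof -
  let ?S = "\<lambda>m i. int (\<Sum>j\<in>{i..n}. m j)"
  let ?w = "\<lambda>m. sp_weight n (?S m)"
  have "prec (2 * n) (Sp n) (dominant_element n m) (dominant_element n m') \<longleftrightarrow>
      (\<forall>r<2 * n. \<forall>c<2 * n. ?w m' r - ?w m' c \<le> max 0 (?w m r - ?w m c))"
    unfolding dominant_element_eq_mat_diag
    by (intro prec_Sp_iff_weights allI impI) (simp_all only: sp_weight_flip)
  also have "\<dots> \<longleftrightarrow> (\<forall>j\<in>{1..n}. m' j \<le> m j)"
  proof
    assume W: "\<forall>r<2 * n. \<forall>c<2 * n. ?w m' r - ?w m' c \<le> max 0 (?w m r - ?w m c)"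
    show "\<forall>j\<in>{1..n}. m' j \<le> m j"
    proof
      fix j assume j: "j \<in> {1..n}"
      show "m' j \<le> m j"
      proof (cases "j < n")
        case True
        have S: "?S m j = int (m j) + ?S m (Suc j)" for m
          using j by (simp add: sum.atLeast_Suc_atMost[of j n])
        from True j obtain k where k: "j = Suc k" "Suc k < n" by (cases j) auto
        \<comment> \<open>the entry \<open>(j - 1, j)\<close> belongs to the simple root \<open>L\<^sub>j - L\<^bsub>j+1\<^esub>\<close>\<close>
        have w: "?w m k = ?S m j" "?w m j = ?S m (Suc j)" for m
          using k by (simp_all add: sp_weight_def)
        have "?w m' k - ?w m' j \<le> max 0 (?w m k - ?w m j)"
          using W k by simp
        then show ?thesis unfolding w S by simp
      next
        case False
        then obtain k where k: "j = n" "n = Suc k" using j by (cases n) auto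
        \<comment> \<open>the entry \<open>(n - 1, 2 n - 1)\<close> belongs to the simple root \<open>2 L\<^sub>n\<close>\<close>
        have w: "?w m k = int (m n)" "?w m (n + k) = - int (m n)" for m
          using k by (simp_all add: sp_weight_def)
        have "?w m' k - ?w m' (n + k) \<le> max 0 (?w m k - ?w m (n + k))"
          using W k by simp
        then show ?thesis unfolding w k(1) by simp
      qed
    qed
  next
    assume le: "\<forall>j\<in>{1..n}. m' j \<le> m j"
    have S_anti: "?S m j \<le> ?S m i" if "i \<le> j" for i j m
      using that by (intro of_nat_mono sum_mono2) auto
    \<comment> \<open>the coordinates of the two elements differ by a function that decreases with the index\<close>
    have S_diff: "?S m i = ?S m' i + ?S (\<lambda>j. m j - m' j) i" if "i \<in> {1..n}" for i
    proof -
      have "(\<Sum>j\<in>{i..n}. m j) = (\<Sum>j\<in>{i..n}. m' j + (m j - m' j))"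
        using le that by (intro sum.cong) auto
      then show ?thesis by (simp add: sum.distrib)
    qed
    have S_le: "?S m' i \<le> ?S m i" "0 \<le> ?S m' i" if "i \<in> {1..n}" for i
      using S_diff[OF that] of_nat_0_le_iff[of "\<Sum>j\<in>{i..n}. m j - m' j"]
        of_nat_0_le_iff[of "\<Sum>j\<in>{i..n}. m' j"] by linarith+
    have S_sub: "?S m' i - ?S m' j \<le> max 0 (?S m i - ?S m j)"
      if ij: "i \<in> {1..n}" "j \<in> {1..n}" for i j
    proof (cases "i \<le> j")
      case True
      show ?thesis using S_diff[OF ij(1)] S_diff[OF ij(2)] S_anti[OF True, of "\<lambda>j. m j - m' j"]
        by linarith
    next
      case False
      then show ?thesis using S_anti[of j i m'] by linarith
    qed
    show "\<forall>r<2 * n. \<forall>c<2 * n. ?w m' r - ?w m' c \<le> max 0 (?w m r - ?w m c)"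
    proof (intro allI impI)
      fix r c assume r: "r < 2 * n" and c: "c < 2 * n"
      from r show "?w m' r - ?w m' c \<le> max 0 (?w m r - ?w m c)"
      proof (cases rule: sp_weight_cases[where 'a = int])
        case (1 i)
        from c show ?thesis
        proof (cases rule: sp_weight_cases[where 'a = int])
          case k: (1 k)
          show ?thesis unfolding 1(2) k(2) by (rule S_sub[OF 1(1) k(1)])
        next
          case k: (2 k)
          show ?thesis unfolding 1(2) k(2) using S_le[OF 1(1)] S_le[OF k(1)] by linarith
        qed
      next
        case (2 i)
        from c show ?thesis
        proof (cases rule: sp_weight_cases[where 'a = int])
          case k: (1 k)
          show ?thesis unfolding 2(2) k(2) using S_le[OF 2(1)] S_le[OF k(1)] by linarith
        next
          case k: (2 k)
          show ?thesis unfolding 2(2) k(2) using S_sub[OF k(1) 2(1)] by linarith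
        qed
      qed
    qed
  qed
  finally show ?thesis .
qed

lemma symmetric_canonical_elements_Sp:
  "symmetric_canonical_elements (2 * n) (Sp n) (sp_torus n) (sp_pos_roots n) =
    {dominant_element n m |m. \<forall>j\<in>{1..n}. m j \<le> 1}"
proof -
  have order: "prec_I (2 * n) (Sp n) (sp_torus n) (dominant_element n m) (dominant_element n m') \<longleftrightarrow>
      (\<forall>j\<in>{1..n}. m' j \<le> m j \<and> even (m j) = even (m' j))" for m m'
    unfolding prec_I_def prec_dominant_element_iff dominant_element_diff_in_square_lattice_iff
    by blast
  have max: "(\<forall>m'. (\<forall>j\<in>{1..n}. m' j \<le> m j \<and> even (m j) = even (m' j)) \<longrightarrow>
      (\<forall>j\<in>{1..n}. m' j = m j)) \<longleftrightarrow> (\<forall>j\<in>{1..n}. m j \<le> 1)" for m :: "nat \<Rightarrow> nat"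
  proof
    assume M: "\<forall>m'. (\<forall>j\<in>{1..n}. m' j \<le> m j \<and> even (m j) = even (m' j)) \<longrightarrow>
      (\<forall>j\<in>{1..n}. m' j = m j)"
    show "\<forall>j\<in>{1..n}. m j \<le> 1"
    proof
      fix k assume k: "k \<in> {1..n}"
      show "m k \<le> 1"
      proof (rule ccontr)
        assume "\<not> m k \<le> 1"
        then have m: "m k \<ge> 2" by simp
        then have "\<forall>j\<in>{1..n}. (m(k := m k - 2)) j = m j"
          \<comment> \<open>lowering a coefficient by two keeps its parity and moves up in the order\<close>
          by (intro M[rule_format, THEN ballI]) auto
        from bspec[OF this k] m show False by simp
      qed
    qed
  next
    assume le: "\<forall>j\<in>{1..n}. m j \<le> 1"
    show "\<forall>m'. (\<forall>j\<in>{1..n}. m' j \<le> m j \<and> even (m j) = even (m' j)) \<longrightarrow>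
      (\<forall>j\<in>{1..n}. m' j = m j)"
    proof (intro allI impI ballI)
      fix m' j assume "\<forall>j\<in>{1..n}. m' j \<le> m j \<and> even (m j) = even (m' j)" and j: "j \<in> {1..n}"
      then have "m' j \<le> m j" "even (m j) = even (m' j)" "m j \<le> 1" using le by auto
      then show "m' j = m j" by (cases "m j"; cases "m' j") auto
    qed
  qed
  have "symmetric_canonical_elements (2 * n) (Sp n) (sp_torus n) (sp_pos_roots n) =
      {dominant_element n m |m. \<forall>m'.
        prec_I (2 * n) (Sp n) (sp_torus n) (dominant_element n m) (dominant_element n m') \<longrightarrow>
        dominant_element n m' = dominant_element n m}"
    unfolding symmetric_canonical_elements_def dominant_lattice_Sp by blast
  then show ?thesis unfolding order dominant_element_eq_iff max .
qed

section \<open>The elements in terms of the dual basis\<close>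

lemma sp_H_eq:
  "j \<in> {1..n} \<Longrightarrow> sp_H n j = torus_element n (\<lambda>i. if i \<le> j then if j < n then 1 else 1 / 2 else 0)"
  unfolding sp_H_explicit finsum_sp_E ..

lemma finsum_torus_element:
  assumes "finite I"
  shows "(\<Oplus>\<^bsub>module_mat TYPE(complex) (2 * n) (2 * n)\<^esub>j\<in>I. torus_element n (h j)) =
    torus_element n (\<lambda>i. \<Sum>j\<in>I. h j i)" (is "?F = _")
proof (rule eq_matI)
  have F: "?F \<in> carrier_mat (2 * n) (2 * n)" using assms by (intro finsum_mat_closed) auto
  then show "dim_row ?F = dim_row (torus_element n (\<lambda>i. \<Sum>j\<in>I. h j i))"
    "dim_col ?F = dim_col (torus_element n (\<lambda>i. \<Sum>j\<in>I. h j i))"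
    by (auto simp: torus_element_def mat_diag_def)
  fix r c assume "r < dim_row (torus_element n (\<lambda>i. \<Sum>j\<in>I. h j i))"
    "c < dim_col (torus_element n (\<lambda>i. \<Sum>j\<in>I. h j i))"
  then have rc: "r < 2 * n" "c < 2 * n" by (simp_all add: torus_element_def mat_diag_def)
  have "?F $$ (r, c) = (\<Sum>j\<in>I. torus_element n (h j) $$ (r, c))"
    using assms rc by (intro index_finsum_mat) auto
  also have "\<dots> = torus_element n (\<lambda>i. \<Sum>j\<in>I. h j i) $$ (r, c)"
    using rc by (simp add: torus_element_def mat_diag_def sp_weight_def sum_distrib_left sum_negf)
  finally show "?F $$ (r, c) = torus_element n (\<lambda>i. \<Sum>j\<in>I. h j i) $$ (r, c)" .
qed

lemma torus_element_add_smult: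
  "torus_element n a + of_real x \<cdot>\<^sub>m torus_element n b = torus_element n (\<lambda>i. a i + x * b i)"
  by (auto simp: torus_element_def mat_diag_def sp_weight_def algebra_simps)

text \<open>
  The summand \<open>H\<^sub>n\<close> of \<open>\<xi>\<^sub>I\<close> has entries \<open>1/2\<close>; the correction term doubles it. Then every \<open>j \<in> I\<close> adds one to the
  first \<open>j\<close> coordinates.
\<close>

lemma sp_xi_plus_delta:
  assumes n: "n \<ge> 1" and I: "I \<subseteq> {1..n}"
  shows "sp_xi n I + sp_delta I n \<cdot>\<^sub>m sp_H n n = dominant_element n (\<lambda>j. of_bool (j \<in> I))"
proof -
  define h where "h j i = (if i \<le> j then if j < n then 1 else 1 / 2 else 0 :: real)" for i j :: nat
  have H: "sp_H n j = torus_element n (h j)" if "j \<in> {1..n}" for j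
    unfolding sp_H_eq[OF that] h_def ..
  have fin: "finite I" using I by (rule finite_subset) simp
  have "sp_xi n I = (\<Oplus>\<^bsub>module_mat TYPE(complex) (2 * n) (2 * n)\<^esub>j\<in>I. torus_element n (h j))"
  proof -
    interpret M: abelian_group "module_mat TYPE(complex) (2 * n) (2 * n)" by (rule abelian_group_mat)
    show ?thesis unfolding sp_xi_def
      using I H by (intro M.finsum_cong') (auto simp: module_mat_simps)
  qed
  also have "\<dots> = torus_element n (\<lambda>i. \<Sum>j\<in>I. h j i)" by (rule finsum_torus_element[OF fin])
  finally have xi: "sp_xi n I = torus_element n (\<lambda>i. \<Sum>j\<in>I. h j i)" .
  have delta: "sp_delta I n = of_real (of_bool (n \<in> I))" by (simp add: sp_delta_def)
  have "(\<Sum>j\<in>I. h j i) + of_bool (n \<in> I) * h n i = real (\<Sum>j\<in>{i..n}. of_bool (j \<in> I))"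
    if i: "i \<in> {1..n}" for i
  proof -
    have "(\<Sum>j\<in>I. h j i) + of_bool (n \<in> I) * h n i = (\<Sum>j\<in>I. h j i + (if j = n then h n i else 0))"
      using fin by (simp add: sum.distrib)
    also have "\<dots> = (\<Sum>j\<in>I. of_bool (i \<le> j))"
      using I i by (intro sum.cong) (auto simp: h_def)
    also have "\<dots> = (\<Sum>j\<in>{i..n}. of_bool (j \<in> I))"
      using I i fin by (intro sum.mono_neutral_cong) auto
    finally show ?thesis by simp
  qed
  then show ?thesis
    using n by (simp add: xi delta H torus_element_add_smult dominant_element_def torus_element_eq_iff
      del: of_nat_sum)
qed

theorem theorem6p6:
  fixes n :: nat
  assumes "n \<ge> 1"
  shows "symmetric_canonical_elements (2 * n) (Sp n) (sp_torus n) (sp_pos_roots n) =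
    {sp_xi n I + sp_delta I n \<cdot>\<^sub>m sp_H n n |I. I \<subseteq> {1..n}}"
proof -
  have "{dominant_element n m |m. \<forall>j\<in>{1..n}. m j \<le> 1} =
      {dominant_element n (\<lambda>j. of_bool (j \<in> I)) |I. I \<subseteq> {1..n}}"
  proof (intro Set.equalityI subsetI)
    fix \<xi> assume "\<xi> \<in> {dominant_element n m |m. \<forall>j\<in>{1..n}. m j \<le> 1}"
    then obtain m where m: "\<xi> = dominant_element n m" "\<forall>j\<in>{1..n}. m j \<le> 1" by blast
    have "m j = of_bool (j \<in> {j \<in> {1..n}. m j = 1})" if "j \<in> {1..n}" for j
      using bspec[OF m(2) that] that by (cases "m j") auto
    then have "\<xi> = dominant_element n (\<lambda>j. of_bool (j \<in> {j \<in> {1..n}. m j = 1}))"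
      unfolding m(1) dominant_element_eq_iff by blast
    then show "\<xi> \<in> {dominant_element n (\<lambda>j. of_bool (j \<in> I)) |I. I \<subseteq> {1..n}}" by blast
  next
    fix \<xi> assume "\<xi> \<in> {dominant_element n (\<lambda>j. of_bool (j \<in> I)) |I. I \<subseteq> {1..n}}"
    then obtain I where "\<xi> = dominant_element n (\<lambda>j. of_bool (j \<in> I))" by blast
    then show "\<xi> \<in> {dominant_element n m |m. \<forall>j\<in>{1..n}. m j \<le> 1}"
      by (intro CollectI exI[of _ "\<lambda>j. of_bool (j \<in> I)"]) simp
  qed
  also have "\<dots> = {sp_xi n I + sp_delta I n \<cdot>\<^sub>m sp_H n n |I. I \<subseteq> {1..n}}"
    using sp_xi_plus_delta[OF assms] by (intro Collect_cong) metis
  finally show ?thesis unfolding symmetric_canonical_elements_Sp .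
qed

end
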